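(* For every integer $k\ge 137$, there is no $s$-extremal singly even self-dual $[24k+8,12k+4,4k+2]$ code. Equivalently, for every integer $k\ge 137$, there is no extremal doubly even self-dual $[24k+8,12k+4,4k+4]$ code with covering radius $4k+2$, meeting the Delsarte bound.
   Context: All codes are binary: an $[n,m]$ code is an $m$-dimensional subspace $C$ of $\mathbb{F}_2^n$, and it is an $[n,m,d]$ code if its minimum non-zero weight $d(C)$ is $d$. The dual is $C^\perp=\{x\in\mathbb{F}_2^n \mid x\cdot y=0 \text{ for all } y\in C\}$ for the standard inner product, and $C$ is self-dual if $C=C^\perp$. A self-dual code is doubly even if all its weights are $\equiv 0\pmod 4$, and singly even if some codeword has weight $\equiv 2\pmod 4$. A self-dual code of length $n$ satisfies $d(C)\le 4\lfloor n/24\rfloor+4$ unless $n\equiv 22\pmod{24}$, in which case $d(C)\le 4\lfloor n/24\rfloor+6$; it is extremal if it meets this bound. For a singly even self-dual code $C$, let $C_0$ be the subcode (of codimension 1) of codewords of weight $\equiv 0\pmod 4$; the shadow of $C$ is $S=C_0^\perp\setminus C$, and $d(S)$ is the minimum non-zero weight of the vectors in $S$. A singly even self-dual code $C$ of length $n$ satisfies $d(S)\le \frac n2+4-2d(C)$ unless $n\equiv 22\pmod{24}$ and $d(C)=4\lfloor n/24\rfloor+6$; outside this exceptional case, $C$ is called $s$-extremal if $d(S)=\frac n2+4-2d(C)$. The covering radius $R(C)$ is the smallest integer $R$ such that the Hamming spheres of radius $R$ around the codewords of $C$ cover $\mathbb{F}_2^n$. The Delsarte bound states $R(C)\le|\{i\mid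 A_i^\perp\neq 0,\ 0<i\le n\}|$, where $A_i^\perp$ is the number of vectors of weight $i$ in $C^\perp$. *)

theory Defs
  imports "HOL-Analysis.Cartesian_Space" "HOL-Library.Z2"
begin

text \<open>
  Binary codes of length \<open>n\<close> are sets of vectors in \<open>bit ^ 'n\<close> with \<open>n = CARD('n)\<close>.
\<close>

definition wt :: "bit ^ 'n \<Rightarrow> nat" where
  "wt x = card {i. x $ i \<noteq> 0}"

definition hamming_dist :: "bit ^ 'n \<Rightarrow> bit ^ 'n \<Rightarrow> nat" where
  "hamming_dist x y = card {i. x $ i \<noteq> y $ i}"

text \<open>Only meaningful if the set contains a nonzero vector.\<close>

definition min_weight :: "(bit ^ 'n) set \<Rightarrow> nat" where
  "min_weight S = Min (wt ` (S - {0}))"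

definition linear_code :: "nat \<Rightarrow> nat \<Rightarrow> (bit ^ 'n) set \<Rightarrow> bool" where
  "linear_code n m C \<longleftrightarrow> CARD('n) = n \<and> vec.subspace C \<and> vec.dim C = m"

definition linear_code_dist :: "nat \<Rightarrow> nat \<Rightarrow> nat \<Rightarrow> (bit ^ 'n) set \<Rightarrow> bool" where
  "linear_code_dist n m d C \<longleftrightarrow>
     linear_code n m C \<and> C - {0} \<noteq> {} \<and> min_weight C = d"

definition dot :: "bit ^ 'n \<Rightarrow> bit ^ 'n \<Rightarrow> bit" where
  "dot x y = (\<Sum>i\<in>UNIV. x $ i * y $ i)"

definition dual_code :: "(bit ^ 'n) set \<Rightarrow> (bit ^ 'n) set" where
  "dual_code C = {x. \<forall>y\<in>C. dot x y = 0}"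

definition self_dual :: "(bit ^ 'n) set \<Rightarrow> bool" where
  "self_dual C \<longleftrightarrow> vec.subspace C \<and> C = dual_code C"

definition doubly_even_self_dual :: "(bit ^ 'n) set \<Rightarrow> bool" where
  "doubly_even_self_dual C \<longleftrightarrow> self_dual C \<and> (\<forall>x\<in>C. wt x mod 4 = 0)"

definition singly_even_self_dual :: "(bit ^ 'n) set \<Rightarrow> bool" where
  "singly_even_self_dual C \<longleftrightarrow> self_dual C \<and> (\<exists>x\<in>C. wt x mod 4 = 2)"

definition extremal :: "(bit ^ 'n) set \<Rightarrow> bool" where
  "extremal C \<longleftrightarrow> self_dual C \<and>
     min_weight C = (if CARD('n) mod 24 = 22 then 4 * (CARD('n) div 24) + 6
                     else 4 * (CARD('n) div 24) + 4)"

definition doubly_even_subcode :: "(bit ^ 'n) set \<Rightarrow> (bit ^ 'n) set" where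
  "doubly_even_subcode C = {x \<in> C. wt x mod 4 = 0}"

definition shadow :: "(bit ^ 'n) set \<Rightarrow> (bit ^ 'n) set" where
  "shadow C = dual_code (doubly_even_subcode C) - C"

text \<open>The bound is stated over the reals to avoid truncated subtraction.\<close>

definition s_extremal :: "(bit ^ 'n) set \<Rightarrow> bool" where
  "s_extremal C \<longleftrightarrow> singly_even_self_dual C \<and>
     \<not> (CARD('n) mod 24 = 22 \<and> min_weight C = 4 * (CARD('n) div 24) + 6) \<and>
     real (min_weight (shadow C)) = real CARD('n) / 2 + 4 - 2 * real (min_weight C)"

definition covering_radius :: "(bit ^ 'n) set \<Rightarrow> nat" where
  "covering_radius C = (LEAST R. (\<Union>c\<in>C. {x. hamming_dist c x \<le> R}) = UNIV)"

definition weight_count :: "(bit ^ 'n) set \<Rightarrow> nat \<Rightarrow> nat" where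
  "weight_count C i = card {x \<in> C. wt x = i}"

definition delsarte_bound :: "(bit ^ 'n) set \<Rightarrow> nat" where
  "delsarte_bound C = card {i. weight_count (dual_code C) i \<noteq> 0 \<and> 0 < i \<and> i \<le> CARD('n)}"

definition meets_delsarte_bound :: "(bit ^ 'n) set \<Rightarrow> bool" where
  "meets_delsarte_bound C \<longleftrightarrow> covering_radius C = delsarte_bound C"

end

theory Submission
  imports Defs "HOL-Computational_Algebra.Polynomial_FPS"
begin

text \<open>
  Let \<open>N = 12k + 4\<close>, so that the length is \<open>2N = 24k + 8\<close>. Both halves of the theorem come down to
  one situation: a self-dual code \<open>C\<close> of this length with all nonzero weights at least \<open>4k + 2\<close>
  and all weights of its shadow at least \<open>4k + 4\<close>. Two things happen. First, these conditions
  leave no freedom: they determine the weight enumerator of \<open>C\<close>. Second, for \<open>k \<ge> 137\<close> the number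
  of codewords of weight \<open>4k + 6\<close> that this enumerator predicts is negative.

  For the first point, on a self-dual code the map \<open>u \<mapsto> wt u / 2\<close> modulo 2 is linear, so the vectors
  \<open>v\<close> with \<open>u \<cdot> v = wt u / 2\<close> for all \<open>u \<in> C\<close> form a coset of \<open>C\<close>, contained in the shadow. A
  MacWilliams identity twisted by the sign \<open>(-1)^(wt u / 2)\<close> expresses the weight enumerator of \<open>C\<close>
  through that of the coset (\<open>macwilliams_half_weight_coset\<close>). The weights in the coset are divisible
  by 4 and symmetric under \<open>w \<mapsto> 2N - w\<close>, so its enumerator is a palindromic form in fourth
  powers. Palindromic forms have a basis (\<open>palindromic_form_decomposition\<close>) that the identity turns
  into Gleason's basis, and the gap of the shadow at both ends removes all but \<open>2k + 1\<close> basis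
  elements: with \<open>Y\<close> marking pairs of ones,
  \<open>\<Sum>u\<in>C. Y^(wt u / 2) = \<Sum>j\<le>2k. d j * Y^j (1 - Y)^(2j) (1 + Y)^(N - 4j)\<close>
  (\<open>weight_polynomial_expansion\<close>).

  For the second point, the left side is \<open>1 + O(Y^(2k+1))\<close>, so after division by \<open>(1 + Y)^N\<close> the
  \<open>d j\<close> are the first coefficients of \<open>(1 + Y)^(-N)\<close> as a series in
  \<open>Y (1 - Y)^2 / (1 + Y)^4\<close>. Lagrange inversion gives them, and also the
  next three, which measure the coefficients of \<open>Y^(2k+1)\<close>, \<open>Y^(2k+2)\<close>, \<open>Y^(2k+3)\<close> on the left
  (\<open>gleason_coefficient_formula\<close>). The coefficient of \<open>Y^(2k+3)\<close> becomes a combination of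
  binomial coefficients whose sign is that of a polynomial in \<open>k\<close>, negative from \<open>k = 137\<close> on
  (\<open>gleason_third_coefficient_negative\<close>).

  An \<open>s\<close>-extremal code satisfies the hypotheses by definition. Given a doubly even extremal code
  \<open>D\<close> of covering radius \<open>4k + 2\<close>, take a vector \<open>v\<close> of weight \<open>4k + 2\<close> that has minimum weight in
  \<open>v + D\<close>; the neighbour of \<open>D\<close> generated by \<open>v\<close> and \<open>{u \<in> D. u \<cdot> v = 0}\<close>
  satisfies them as well.
\<close>

section \<open>Characters and the MacWilliams identity for a coset of the dual\<close>

text \<open>
  The nontrivial character of the additive group of the field with two elements.
\<close>

definition bit_sign :: "bit \<Rightarrow> 'a::comm_ring_1" where
  "bit_sign b = (if b = 0 then 1 else - 1)"

lemma bit_sign_add: "bit_sign (a + b) = bit_sign a * bit_sign b"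
  by (cases a; cases b) (simp_all add: bit_sign_def)

lemma bit_sign_sum: "finite A \<Longrightarrow> bit_sign (sum f A) = (\<Prod>a\<in>A. bit_sign (f a))"
proof (induction A rule: finite_induct)
  case empty
  then show ?case by (simp add: bit_sign_def)
next
  case (insert a A)
  then show ?case by (simp only: sum.insert prod.insert bit_sign_add simp_thms)
qed

lemma bit_add_eq_0_iff: "a + b = 0 \<longleftrightarrow> b = a" for a b :: bit
  by (cases a; cases b) simp_all

text \<open>
  Orthogonality of characters: if \<open>h w = 1\<close>, translation by \<open>w\<close> permutes \<open>C\<close> and changes the sign of every
  summand, so the sum equals its own negative.
\<close>

lemma sum_bit_sign_hom:
  fixes C :: "(bit ^ 'n) set"
  assumes add: "\<And>u v. u \<in> C \<Longrightarrow> v \<in> C \<Longrightarrow> u + v \<in> C"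
    and hom: "\<And>u v. u \<in> C \<Longrightarrow> v \<in> C \<Longrightarrow> h (u + v) = h u + h v"
  shows "(\<Sum>u\<in>C. bit_sign (h u) :: 'a::{idom,ring_char_0})
     = (if \<forall>u\<in>C. h u = 0 then of_nat (card C) else 0)"
proof (cases "\<forall>u\<in>C. h u = 0")
  case True
  then show ?thesis by (simp add: bit_sign_def)
next
  case False
  then obtain w where w: "w \<in> C" "h w = 1" by auto
  have ww: "w + (w + u) = u" for u
    by (simp add: vec_eq_iff flip: add.assoc)
  have "bij_betw (\<lambda>u. w + u) C C"
    by (rule bij_betwI[where g = "\<lambda>u. w + u"]) (use add w ww in auto)
  then have "(\<Sum>u\<in>C. bit_sign (h u) :: 'a) = (\<Sum>u\<in>C. bit_sign (h (w + u)))"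
    by (rule sum.reindex_bij_betw[symmetric])
  also have "\<dots> = (\<Sum>u\<in>C. - bit_sign (h u))"
    by (rule sum.cong) (use w hom in \<open>auto simp: bit_sign_def\<close>)
  finally have "(\<Sum>u\<in>C. bit_sign (h u) :: 'a) = 0"
    by (simp add: sum_negf)
  with False show ?thesis by auto
qed

lemma dot_add_left: "dot (u + v) w = dot u w + dot v w"
  by (simp only: dot_def vector_add_component distrib_left distrib_right sum.distrib)

lemma dot_add_right: "dot w (u + v) = dot w u + dot w v"
  by (simp only: dot_def vector_add_component distrib_left distrib_right sum.distrib)

lemma dot_commute: "dot u v = dot v u"
  by (simp only: dot_def mult.commute)

lemma wt_le: "wt (u :: bit ^ 'n) \<le> CARD('n)"
  unfolding wt_def by (rule card_mono) auto

lemma bij_betw_support: "bij_betw (\<lambda>v :: bit ^ 'n. {i. v $ i \<noteq> 0}) UNIV (Pow UNIV)"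
  by (rule bij_betwI[where g = "\<lambda>B. \<chi> i. if i \<in> B then 1 else 0"]) (auto simp: vec_eq_iff)

lemma finite_vectors [simp]: "finite (A :: (bit ^ 'n) set)"
proof -
  have "finite (UNIV :: (bit ^ 'n) set)"
    using bij_betw_finite[OF bij_betw_support] by simp
  then show ?thesis by (rule rev_finite_subset) simp
qed

text \<open>
  Both sides are the product over the coordinates \<open>i\<close> of \<open>x + bit_sign (u $ i) * y\<close>: on the left the factors are
  collected by value, on the right the product is expanded, one term for each support.
\<close>

lemma product_character_expansion:
  fixes u :: "bit ^ 'n" and x y :: "'a::comm_ring_1"
  shows "(x + y) ^ (CARD('n) - wt u) * (x - y) ^ wt u
     = (\<Sum>v\<in>UNIV. bit_sign (dot u v) * x ^ (CARD('n) - wt v) * y ^ wt v)"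
proof -
  define supp where "supp = (\<lambda>v :: bit ^ 'n. {i. v $ i \<noteq> 0})"
  have bij: "bij_betw supp UNIV (Pow UNIV)"
    unfolding supp_def by (rule bij_betw_support)
  have "(x + y) ^ (CARD('n) - wt u) * (x - y) ^ wt u
      = (\<Prod>i\<in>UNIV. if u $ i \<noteq> 0 then x - y else x + y)"
  proof -
    have "card (- {i. u $ i = 1}) = CARD('n) - card {i. u $ i = 1}"
      by (simp add: card_Diff_subset Compl_eq_Diff_UNIV)
    then show ?thesis
      by (simp add: prod.If_cases wt_def mult.commute)
  qed
  also have "\<dots> = (\<Prod>i\<in>UNIV. bit_sign (u $ i) * y + x)"
    by (rule prod.cong) (auto simp: bit_sign_def)
  also have "\<dots> = (\<Sum>B\<in>Pow UNIV. (\<Prod>i\<in>B. bit_sign (u $ i) * y) * (\<Prod>i\<in>UNIV - B. x))"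
    by (rule prod_add) simp
  also have "\<dots> = (\<Sum>v\<in>UNIV. (\<Prod>i\<in>supp v. bit_sign (u $ i) * y) * (\<Prod>i\<in>UNIV - supp v. x))"
    by (rule sum.reindex_bij_betw[OF bij, symmetric])
  also have "\<dots> = (\<Sum>v\<in>UNIV. bit_sign (dot u v) * x ^ (CARD('n) - wt v) * y ^ wt v)"
  proof (rule sum.cong)
    fix v :: "bit ^ 'n"
    have "bit_sign (dot u v) = (\<Prod>i\<in>UNIV. bit_sign (u $ i * v $ i) :: 'a)"
      by (simp only: dot_def) (rule bit_sign_sum, simp)
    also have "\<dots> = (\<Prod>i\<in>supp v. bit_sign (u $ i * v $ i))"
      by (rule prod.mono_neutral_right) (auto simp: supp_def bit_sign_def)
    also have "\<dots> = (\<Prod>i\<in>supp v. bit_sign (u $ i))"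
      by (rule prod.cong) (auto simp: supp_def)
    finally have d: "(\<Prod>i\<in>supp v. bit_sign (u $ i)) = (bit_sign (dot u v) :: 'a)" by simp
    have "card (UNIV - supp v) = CARD('n) - wt v"
      by (simp add: card_Diff_subset supp_def wt_def)
    then show "(\<Prod>i\<in>supp v. bit_sign (u $ i) * y) * (\<Prod>i\<in>UNIV - supp v. x)
        = bit_sign (dot u v) * x ^ (CARD('n) - wt v) * y ^ wt v"
      by (simp add: prod.distrib d) (simp add: supp_def wt_def mult_ac)
  qed simp
  finally show ?thesis .
qed

text \<open>
  For \<open>t = 0\<close> this is the MacWilliams identity. The linear functional \<open>t\<close> replaces the dual code by the coset
  of those \<open>v\<close> that represent \<open>t\<close> on \<open>C\<close> through the inner product.
\<close>

lemma macwilliams_twisted: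
  fixes C :: "(bit ^ 'n) set" and x y :: "'a::{idom,ring_char_0}"
  assumes add: "\<And>u v. u \<in> C \<Longrightarrow> v \<in> C \<Longrightarrow> u + v \<in> C"
    and hom: "\<And>u v. u \<in> C \<Longrightarrow> v \<in> C \<Longrightarrow> t (u + v) = t u + t v"
  shows "(\<Sum>u\<in>C. bit_sign (t u) * (x + y) ^ (CARD('n) - wt u) * (x - y) ^ wt u)
     = of_nat (card C) * (\<Sum>v | \<forall>u\<in>C. dot u v = t u. x ^ (CARD('n) - wt v) * y ^ wt v)"
    (is "?lhs = _ * sum ?m _")
proof -
  have inner: "(\<Sum>u\<in>C. bit_sign (t u + dot u v) :: 'a)
      = (if \<forall>u\<in>C. dot u v = t u then of_nat (card C) else 0)" for v
  proof -
    have "(\<Sum>u\<in>C. bit_sign (t u + dot u v) :: 'a)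
        = (if \<forall>u\<in>C. t u + dot u v = 0 then of_nat (card C) else 0)"
    proof (rule sum_bit_sign_hom)
      fix u w assume "u \<in> C" "w \<in> C"
      then show "u + w \<in> C" "t (u + w) + dot (u + w) v = (t u + dot u v) + (t w + dot w v)"
        by (simp_all only: add hom dot_add_left add.assoc add.left_commute)
    qed
    then show ?thesis by (simp only: bit_add_eq_0_iff)
  qed
  have "?lhs = (\<Sum>u\<in>C. \<Sum>v\<in>UNIV. bit_sign (t u + dot u v) * ?m v)"
    by (simp only: mult.assoc product_character_expansion)
       (simp only: sum_distrib_left mult.assoc bit_sign_add)
  also have "\<dots> = (\<Sum>v\<in>UNIV. (\<Sum>u\<in>C. bit_sign (t u + dot u v)) * ?m v)"
    by (subst sum.swap) (simp add: sum_distrib_right)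
  also have "\<dots> = (\<Sum>v\<in>UNIV. (if \<forall>u\<in>C. dot u v = t u then of_nat (card C) else 0) * ?m v)"
    by (simp only: inner)
  also have "\<dots> = (\<Sum>v | \<forall>u\<in>C. dot u v = t u. of_nat (card C) * ?m v)"
    by (rule sum.mono_neutral_cong_right) auto
  finally show ?thesis by (simp add: sum_distrib_left)
qed

section \<open>Self-dual codes and their shadows\<close>

lemma dot_eq_card: "dot u v = of_nat (card {i. u $ i = 1 \<and> v $ i = 1})"
proof -
  have "dot u v = (\<Sum>i\<in>UNIV. if u $ i = 1 \<and> v $ i = 1 then 1 else 0)"
    unfolding dot_def by (rule sum.cong) (auto simp flip: bit_not_zero_iff)
  also have "\<dots> = (\<Sum>i\<in>{i. u $ i = 1 \<and> v $ i = 1}. 1)"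
    by (rule sum.mono_neutral_cong_right) auto
  finally show ?thesis by simp
qed

lemma wt_add: "wt (u + v) + 2 * card {i. u $ i = 1 \<and> v $ i = 1} = wt u + wt v"
proof -
  let ?U = "{i. u $ i = 1}" and ?V = "{i. v $ i = 1}"
  have "a + b \<noteq> 0 \<longleftrightarrow> (a = 1 \<and> b \<noteq> 1) \<or> (b = 1 \<and> a \<noteq> 1)" for a b :: bit
    by (cases a; cases b) auto
  then have "{i. (u + v) $ i \<noteq> 0} = (?U - ?V) \<union> (?V - ?U)"
    unfolding vector_add_component by blast
  then have e: "wt (u + v) = card ((?U - ?V) \<union> (?V - ?U))"
    by (simp only: wt_def)
  have "card ?U = card (?U - ?V) + card (?U \<inter> ?V)"
    using card_Diff_subset_Int[of ?U ?V] card_mono[of ?U "?U \<inter> ?V"] by simp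
  moreover have "card ?V = card (?V - ?U) + card (?U \<inter> ?V)"
    using card_Diff_subset_Int[of ?V ?U] card_mono[of ?V "?V \<inter> ?U"] by (simp add: Int_commute)
  moreover have "card ((?U - ?V) \<union> (?V - ?U)) = card (?U - ?V) + card (?V - ?U)"
    by (rule card_Un_disjoint) auto
  moreover have "?U \<inter> ?V = {i. u $ i = 1 \<and> v $ i = 1}" by auto
  ultimately show ?thesis unfolding e by (simp add: wt_def)
qed

lemma of_nat_bit: "(of_nat m :: bit) = 0 \<longleftrightarrow> even m"
proof (induction m)
  case (Suc m)
  then show ?case by (cases "of_nat m :: bit") (auto simp: of_nat_Suc)
qed simp

lemma wt_eq_0_iff: "wt u = 0 \<longleftrightarrow> u = 0"
  by (auto simp: wt_def vec_eq_iff)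

lemma wt_zero: "wt 0 = 0"
  by (simp add: wt_def)

lemma dot_self: "dot u u = of_nat (wt u)"
  unfolding dot_eq_card wt_def by simp

lemma dot_zero_left: "dot 0 v = 0"
  unfolding dot_def by simp

lemma wt_all_ones: "wt (\<chi> i. 1 :: bit ^ 'n) = CARD('n)"
  by (simp add: wt_def)

lemma dot_all_ones: "dot u (\<chi> i. 1) = of_nat (wt u)"
  unfolding dot_eq_card wt_def by simp

lemma wt_add_all_ones: "wt (v + (\<chi> i. 1) :: bit ^ 'n) = CARD('n) - wt v"
  using wt_add[of v "\<chi> i. 1"] wt_all_ones[where 'n = 'n] by (simp add: wt_def)

lemma self_dual_subspace: "self_dual C \<Longrightarrow> vec.subspace C"
  unfolding self_dual_def by (rule conjunct1)

lemma self_dual_eq_dual: "self_dual C \<Longrightarrow> dual_code C = C"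
  unfolding self_dual_def by (elim conjE) (rule sym)

lemma self_dual_dot:
  assumes "self_dual C" "u \<in> C" "v \<in> C"
  shows "dot u v = 0"
proof -
  have "u \<in> dual_code C" using assms(2) self_dual_eq_dual[OF assms(1)] by simp
  then show ?thesis using assms(3) by (simp add: dual_code_def)
qed

lemma self_dual_memI:
  assumes "self_dual C" "\<And>u. u \<in> C \<Longrightarrow> dot v u = 0"
  shows "v \<in> C"
proof -
  have "v \<in> dual_code C" using assms(2) by (simp add: dual_code_def)
  then show ?thesis using self_dual_eq_dual[OF assms(1)] by simp
qed

lemma self_dual_add: "self_dual C \<Longrightarrow> u \<in> C \<Longrightarrow> v \<in> C \<Longrightarrow> u + v \<in> C"
  by (rule vec.subspace_add[OF self_dual_subspace])

lemma self_dual_zero: "self_dual C \<Longrightarrow> 0 \<in> C"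
  by (rule vec.subspace_0[OF self_dual_subspace])

lemma self_dual_even_wt: "self_dual C \<Longrightarrow> u \<in> C \<Longrightarrow> even (wt u)"
  using self_dual_dot[of C u u] by (simp only: dot_self of_nat_bit)

text \<open>
  By \<open>wt_add\<close>, halving the weights leaves the size of the common support as the defect of additivity, and that
  size is even because \<open>u\<close> and \<open>v\<close> are orthogonal.
\<close>

lemma half_weight_hom:
  assumes "self_dual C" "u \<in> C" "v \<in> C"
  shows "(of_nat (wt (u + v) div 2) :: bit) = of_nat (wt u div 2) + of_nat (wt v div 2)"
proof -
  let ?c = "card {i. u $ i = 1 \<and> v $ i = 1}"
  have "even ?c"
    using self_dual_dot[OF assms] by (simp only: dot_eq_card of_nat_bit)
  then have c: "(of_nat ?c :: bit) = 0" by (simp only: of_nat_bit)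
  have "even (wt u)" "even (wt v)" "even (wt (u + v))"
    using self_dual_even_wt[OF assms(1)] assms(2,3) self_dual_add[OF assms] by blast+
  moreover have "p div 2 + c = a div 2 + b div 2"
    if "p + 2 * c = a + b" "even a" "even b" "even p" for a b c p :: nat
    using that by (elim evenE) simp
  ultimately have "wt (u + v) div 2 + ?c = wt u div 2 + wt v div 2"
    using wt_add[of u v] by blast
  then have "(of_nat (wt (u + v) div 2 + ?c) :: bit) = of_nat (wt u div 2 + wt v div 2)"
    by (rule arg_cong)
  then show ?thesis unfolding of_nat_add c add_0_right .
qed

text \<open>
  For singly even \<open>C\<close> this is the shadow, written as the set of solutions of the linear equations that cut out a
  coset of \<open>C\<close>. In this form it is what \<open>macwilliams_twisted\<close> produces.
\<close>

definition half_weight_coset :: "(bit ^ 'n) set \<Rightarrow> (bit ^ 'n) set" where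
  "half_weight_coset C = {v. \<forall>u\<in>C. dot u v = of_nat (wt u div 2)}"

lemma half_weight_coset_subset_shadow:
  assumes "singly_even_self_dual C"
  shows "half_weight_coset C \<subseteq> shadow C"
proof
  fix v assume v: "v \<in> half_weight_coset C"
  have sd: "self_dual C" using assms by (simp add: singly_even_self_dual_def)
  obtain u0 where u0: "u0 \<in> C" "wt u0 mod 4 = 2"
    using assms by (auto simp: singly_even_self_dual_def)
  have "dot v u = 0" if "u \<in> doubly_even_subcode C" for u
  proof -
    have "u \<in> C" "even (wt u div 2)"
      using that by (auto simp: doubly_even_subcode_def)
    then show ?thesis
      using v of_nat_bit[of "wt u div 2"] by (simp only: half_weight_coset_def mem_Collect_eq dot_commute[of v])
  qed
  moreover have "v \<notin> C"
  proof
    assume "v \<in> C"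
    then have "dot u0 v = 0" using self_dual_dot[OF sd] u0 by blast
    moreover have "odd (wt u0 div 2)" using u0 by presburger
    moreover have "dot u0 v = of_nat (wt u0 div 2)"
      using v u0(1) unfolding half_weight_coset_def by blast
    ultimately show False using of_nat_bit[of "wt u0 div 2"] by simp
  qed
  ultimately show "v \<in> shadow C" by (auto simp: shadow_def dual_code_def)
qed

lemma macwilliams_half_weight_coset:
  fixes C :: "(bit ^ 'n) set" and x y :: "'a::{idom,ring_char_0}"
  assumes sd: "self_dual C"
  shows "(\<Sum>u\<in>C. (-1) ^ (wt u div 2) * (x + y) ^ (CARD('n) - wt u) * (x - y) ^ wt u)
     = of_nat (card C) * (\<Sum>v\<in>half_weight_coset C. x ^ (CARD('n) - wt v) * y ^ wt v)"
proof -
  have sign: "bit_sign (of_nat m) = (-1 :: 'a) ^ m" for m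
    unfolding bit_sign_def of_nat_bit by simp
  have "(\<Sum>u\<in>C. bit_sign (of_nat (wt u div 2)) * (x + y) ^ (CARD('n) - wt u) * (x - y) ^ wt u)
     = of_nat (card C) * (\<Sum>v | \<forall>u\<in>C. dot u v = of_nat (wt u div 2). x ^ (CARD('n) - wt v) * y ^ wt v)"
    by (rule macwilliams_twisted) (erule (1) self_dual_add[OF sd] half_weight_hom[OF sd])+
  then show ?thesis unfolding sign half_weight_coset_def .
qed

text \<open>
  Evaluating an enumerator at \<open>y = 0\<close>, with \<open>0 ^ 0 = 1\<close>: only the zero codeword survives. The cardinalities below
  are MacWilliams identities at \<open>x = y = 1\<close>, where the factor \<open>(x - y) ^ wt u\<close> has this form.
\<close>

lemma sum_vanishing_power_wt:
  assumes "0 \<in> C"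
  shows "(\<Sum>u\<in>C. f u * 0 ^ wt u) = (f 0 :: 'a::comm_ring_1)"
proof -
  have "(\<Sum>u\<in>C. f u * 0 ^ wt u) = (\<Sum>u\<in>{0}. f u * 0 ^ wt u)"
  proof (rule sum.mono_neutral_right)
    show "\<forall>u\<in>C - {0}. f u * 0 ^ wt u = 0"
    proof
      fix u assume "u \<in> C - {0}"
      then have "0 < wt u" using wt_eq_0_iff[of u] by blast
      then show "f u * 0 ^ wt u = 0" by (simp only: zero_power mult_zero_right)
    qed
  qed (use assms in simp_all)
  then show ?thesis by (simp add: wt_zero)
qed

lemma card_self_dual_squared:
  fixes C :: "(bit ^ 'n) set"
  assumes sd: "self_dual C"
  shows "card C * card C = 2 ^ CARD('n)"
proof -
  \<comment> \<open>The MacWilliams identity without twist: here the coset is the dual code, which is \<open>C\<close>.\<close>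
  have "{v. \<forall>u\<in>C. dot u v = 0} = C"
    using self_dual_eq_dual[OF sd] unfolding dual_code_def by (simp only: dot_commute)
  moreover have "(\<Sum>u\<in>C. bit_sign 0 * (1 + 1) ^ (CARD('n) - wt u) * (1 - 1) ^ wt u)
      = int (card C) * (\<Sum>v | \<forall>u\<in>C. dot u v = 0. 1 ^ (CARD('n) - wt v) * 1 ^ wt v)"
    by (rule macwilliams_twisted) (erule (1) self_dual_add[OF sd], simp)
  ultimately have "(\<Sum>u\<in>C. (2::int) ^ (CARD('n) - wt u) * 0 ^ wt u) = int (card C * card C)"
    by (simp only: bit_sign_def refl if_True one_add_one diff_self mult_1 power_one sum_constant mult_1_right of_nat_mult)
  then have "int (card C * card C) = int (2 ^ CARD('n))"
    unfolding sum_vanishing_power_wt[OF self_dual_zero[OF sd]] by (simp add: wt_zero)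
  then show ?thesis by (simp only: of_nat_eq_iff)
qed

lemma card_half_weight_coset:
  fixes C :: "(bit ^ 'n) set"
  assumes sd: "self_dual C"
  shows "card (half_weight_coset C) = card C"
proof -
  have "(\<Sum>u\<in>C. ((-1) ^ (wt u div 2) * (2::int) ^ (CARD('n) - wt u)) * 0 ^ wt u) = int (card C * card (half_weight_coset C))"
    using macwilliams_half_weight_coset[OF sd, of "1::int" 1] by (simp only: one_add_one diff_self mult_1 power_one sum_constant mult_1_right of_nat_mult)
  then have "int (card C * card (half_weight_coset C)) = int (2 ^ CARD('n))"
    unfolding sum_vanishing_power_wt[OF self_dual_zero[OF sd]] by (simp add: wt_zero)
  then have "card C * card (half_weight_coset C) = card C * card C"
    unfolding card_self_dual_squared[OF sd] by (simp only: of_nat_eq_iff)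
  moreover have "card C \<noteq> 0" using self_dual_zero[OF sd] card_0_eq[OF finite_vectors, of C] by blast
  ultimately show ?thesis by simp
qed

text \<open>
  A Gauss sum argument. At \<open>x = 1\<close>, \<open>y = \<i>\<close> the twist cancels the phases of the summands on the code side,
  because \<open>(1 - \<i>)\<^sup>2 = - (1 + \<i>)\<^sup>2\<close>, and leaves \<open>(1 + \<i>) ^ n = 2 ^ (n / 2)\<close> for each codeword,
  where \<open>n\<close> is the length, divisible by 8. Hence the sum of \<open>\<i> ^ wt v\<close> over the coset equals the number of its
  elements, and a sum of unit complex numbers can be that large only if each of them is 1.
\<close>

lemma half_weight_coset_wt_mod_4:
  fixes C :: "(bit ^ 'n) set"
  assumes sd: "self_dual C" and n: "CARD('n) mod 8 = 0" and v: "v \<in> half_weight_coset C"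
  shows "wt v mod 4 = 0"
proof -
  define N where "N = CARD('n) div 2"
  have nN: "CARD('n) = 2 * N" and N4: "N mod 4 = 0" using n by (auto simp: N_def)
  have i4: "\<i> ^ (4 * q) = 1" for q by (simp add: power_mult)
  have cC: "card C = 2 ^ N"
  proof -
    have "(card C)\<^sup>2 = (2 ^ N)\<^sup>2"
      using card_self_dual_squared[OF sd] by (simp add: nN power_mult_distrib power2_eq_square flip: power_mult power_add mult_2)
    then show ?thesis by simp
  qed
  have "(\<Sum>u\<in>C. (-1) ^ (wt u div 2) * (1 + \<i>) ^ (CARD('n) - wt u) * (1 - \<i>) ^ wt u) = (\<Sum>u\<in>C. 2 ^ N)"
  proof (rule sum.cong)
    fix u assume "u \<in> C"
    then obtain m where m: "wt u = 2 * m" using self_dual_even_wt[OF sd] by (metis evenE)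
    have mN: "m \<le> N" using wt_le[of u] by (simp add: m nN)
    have s: "(1 + \<i>)\<^sup>2 = 2 * \<i>" "(1 - \<i>)\<^sup>2 = - 1 * (2 * \<i>)"
      by (simp_all add: power2_eq_square algebra_simps)
    have "(1 + \<i>) ^ (CARD('n) - wt u) * (1 - \<i>) ^ wt u = (2 * \<i>) ^ (N - m) * ((-1) ^ m * (2 * \<i>) ^ m)"
      by (simp only: m nN diff_mult_distrib2[symmetric] power_mult s power_mult_distrib[of "-1"])
    also have "\<dots> = (-1) ^ m * ((2 * \<i>) ^ (N - m) * (2 * \<i>) ^ m)"
      by (simp only: mult.left_commute)
    also have "(2 * \<i>) ^ (N - m) * (2 * \<i>) ^ m = (2 * \<i>) ^ N"
      using mN by (simp only: power_add[symmetric] le_add_diff_inverse2)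
    also have "(2 * \<i>) ^ N = 2 ^ N"
      using N4 i4[of "N div 4"] by (auto simp: power_mult_distrib)
    finally show "(-1) ^ (wt u div 2) * (1 + \<i>) ^ (CARD('n) - wt u) * (1 - \<i>) ^ wt u = 2 ^ N"
      by (simp add: m mult.assoc flip: power_add mult_2)
  qed simp
  then have "2 ^ N * (\<Sum>v\<in>half_weight_coset C. \<i> ^ wt v) = (2 ^ N * 2 ^ N :: complex)"
    using macwilliams_half_weight_coset[OF sd, of 1 \<i>] by (simp add: cC)
  then have "(\<Sum>v\<in>half_weight_coset C. \<i> ^ wt v) = of_nat (card (half_weight_coset C))"
    by (simp add: card_half_weight_coset[OF sd] cC)
  then have "(\<Sum>v\<in>half_weight_coset C. 1 - Re (\<i> ^ wt v)) = 0"
    by (simp add: sum_subtractf flip: Re_sum)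
  moreover have "1 - Re (\<i> ^ m) \<ge> 0" for m
    using complex_Re_le_cmod[of "\<i> ^ m"] by (simp add: norm_power)
  ultimately have "Re (\<i> ^ wt v) = 1"
    using v sum_nonneg_eq_0_iff[of "half_weight_coset C" "\<lambda>v. 1 - Re (\<i> ^ wt v)"] by simp
  moreover have "\<i> ^ wt v = \<i> ^ (wt v mod 4)"
  proof -
    have "\<i> ^ wt v = \<i> ^ (4 * (wt v div 4) + wt v mod 4)" by simp
    then show ?thesis by (simp only: power_add i4 mult_1)
  qed
  ultimately have Re_1: "Re (\<i> ^ (wt v mod 4)) = 1" by (simp only:)
  have "wt v mod 4 < 4" by simp
  then have "wt v mod 4 = 0 \<or> wt v mod 4 = 1 \<or> wt v mod 4 = 2 \<or> wt v mod 4 = 3"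
    by linarith
  then show ?thesis
    using Re_1 by (elim disjE) (simp_all add: power3_eq_cube)
qed

text \<open>
  Adding the all-ones vector preserves the coset, as codewords have even weight, and complements supports.
\<close>

lemma half_weight_coset_weight_symmetric:
  fixes C :: "(bit ^ 'n) set"
  assumes sd: "self_dual C" and w: "w \<le> CARD('n)"
  shows "card {v \<in> half_weight_coset C. wt v = CARD('n) - w} = card {v \<in> half_weight_coset C. wt v = w}"
proof -
  let ?j = "(\<chi> i. 1) :: bit ^ 'n"
  have in_S: "v + ?j \<in> half_weight_coset C" if "v \<in> half_weight_coset C" for v
  proof -
    have "dot u ?j = 0" if "u \<in> C" for u
      using self_dual_even_wt[OF sd that] by (simp only: dot_all_ones of_nat_bit)
    then show ?thesis using that by (simp add: half_weight_coset_def dot_add_right)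
  qed
  have inv: "v + ?j + ?j = v" for v by (simp add: vec_eq_iff)
  have "bij_betw (\<lambda>v. v + ?j) {v \<in> half_weight_coset C. wt v = w} {v \<in> half_weight_coset C. wt v = CARD('n) - w}"
    by (rule bij_betwI[where g = "\<lambda>v. v + ?j"])
       (use in_S inv w in \<open>auto simp: wt_add_all_ones\<close>)
  then show ?thesis by (simp add: bij_betw_same_card)
qed

section \<open>The weight polynomial of a code with long shadow\<close>

text \<open>
  Subtracting \<open>b 0 * (x - y) ^ (2 * M)\<close> cancels both extreme coefficients; what remains is \<open>x * y\<close> times a
  palindromic form of degree smaller by 2.
\<close>

lemma palindromic_form_decomposition:
  fixes b :: "nat \<Rightarrow> real"
  assumes "\<And>i. i \<le> 2 * M \<Longrightarrow> b i = b (2 * M - i)"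
  shows "\<exists>c. \<forall>x y. (\<Sum>i\<le>2 * M. b i * x ^ (2 * M - i) * y ^ i)
           = (\<Sum>j\<le>M. c j * (x * y) ^ (M - j) * (x - y) ^ (2 * j))"
  using assms
proof (induction M arbitrary: b)
  case 0
  show ?case by (rule exI[of _ b]) simp
next
  case (Suc M)
  let ?n = "2 * Suc M"
  define a where "a i = b i - b 0 * ((-1) ^ i * real (?n choose i))" for i
  have a0: "a 0 = 0" by (simp add: a_def)
  have sym: "a i = a (?n - i)" if "i \<le> ?n" for i
  proof -
    have "(-1 :: real) ^ (?n - i) = (-1) ^ i"
      using that by (simp add: minus_one_power_iff)
    then show ?thesis
      using Suc.prems[OF that] binomial_symmetric[OF that] by (simp add: a_def)
  qed
  have an: "a ?n = 0" using sym[of 0] a0 by simp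
  have "\<exists>c. \<forall>x y. (\<Sum>i\<le>2 * M. a (Suc i) * x ^ (2 * M - i) * y ^ i)
           = (\<Sum>j\<le>M. c j * (x * y) ^ (M - j) * (x - y) ^ (2 * j))"
  proof (rule Suc.IH)
    fix i assume "i \<le> 2 * M"
    then show "a (Suc i) = a (Suc (2 * M - i))"
      using sym[of "Suc i"] by (simp add: Suc_diff_le)
  qed
  then obtain c where c: "\<And>x y. (\<Sum>i\<le>2 * M. a (Suc i) * x ^ (2 * M - i) * y ^ i)
           = (\<Sum>j\<le>M. c j * (x * y) ^ (M - j) * (x - y) ^ (2 * j))" by blast
  show ?case
  proof (intro exI allI)
    fix x y :: real
    have binom: "(x - y) ^ ?n = (\<Sum>i\<le>?n. (-1) ^ i * real (?n choose i) * x ^ (?n - i) * y ^ i)"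
    proof -
      have "(x - y) ^ ?n = (- y + x) ^ ?n" by simp
      also have "\<dots> = (\<Sum>i\<le>?n. real (?n choose i) * (- y) ^ i * x ^ (?n - i))"
        by (rule binomial_ring)
      also have "\<dots> = (\<Sum>i\<le>?n. (-1) ^ i * real (?n choose i) * x ^ (?n - i) * y ^ i)"
        by (rule sum.cong) (simp_all add: power_minus[of y])
      finally show ?thesis .
    qed
    have "(\<Sum>i\<le>?n. b i * x ^ (?n - i) * y ^ i)
        = (\<Sum>i\<le>?n. a i * x ^ (?n - i) * y ^ i) + b 0 * (x - y) ^ ?n"
      unfolding binom sum_distrib_left sum.distrib[symmetric]
      by (rule sum.cong) (simp_all add: a_def algebra_simps)
    also have "(\<Sum>i\<le>?n. a i * x ^ (?n - i) * y ^ i)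
        = (\<Sum>i\<le>2 * M. a (Suc i) * x ^ (?n - Suc i) * y ^ Suc i)"
    proof -
      have "(\<Sum>i\<le>?n. a i * x ^ (?n - i) * y ^ i) = (\<Sum>i\<le>Suc (2 * M). a i * x ^ (?n - i) * y ^ i)"
        using an by (simp del: sum.atMost_Suc add: sum.atMost_Suc[of _ "Suc (2 * M)"])
      also have "\<dots> = (\<Sum>i\<le>2 * M. a (Suc i) * x ^ (?n - Suc i) * y ^ Suc i)"
        unfolding sum.atMost_Suc_shift using a0 by simp
      finally show ?thesis .
    qed
    also have "\<dots> = (x * y) * (\<Sum>i\<le>2 * M. a (Suc i) * x ^ (2 * M - i) * y ^ i)"
      unfolding sum_distrib_left
    proof (rule sum.cong)
      fix i assume "i \<in> {..2 * M}"
      then have "?n - Suc i = Suc (2 * M - i)" by auto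
      then show "a (Suc i) * x ^ (?n - Suc i) * y ^ Suc i
          = x * y * (a (Suc i) * x ^ (2 * M - i) * y ^ i)" by (simp add: mult_ac)
    qed simp
    also have "\<dots> = (\<Sum>j\<le>M. c j * (x * y) ^ (Suc M - j) * (x - y) ^ (2 * j))"
      unfolding c sum_distrib_left
      by (rule sum.cong) (auto simp: Suc_diff_le mult_ac)
    finally show "(\<Sum>i\<le>?n. b i * x ^ (?n - i) * y ^ i)
        = (\<Sum>j\<le>Suc M. (c(Suc M := b 0)) j * (x * y) ^ (Suc M - j) * (x - y) ^ (2 * j))"
      by simp
  qed
qed

text \<open>
  The form of the enumerator of a self-dual code given by Gleason's theorem, cut off at \<open>j = 2k\<close>. The enumerator
  of the coset is a palindromic form in \<open>x ^ 4\<close>, \<open>y ^ 4\<close>; it is divisible by \<open>(x * y) ^ (4 * (k + 1))\<close>, and the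
  quotient has only \<open>2k + 1\<close> components. Taking \<open>1 + y\<close> for \<open>x\<close> and \<open>1 - y\<close> for \<open>y\<close> in the MacWilliams
  identity sends \<open>x * y\<close> to \<open>1 - y\<^sup>2\<close> and \<open>x ^ 4 - y ^ 4\<close> to \<open>8 * y * (1 + y\<^sup>2)\<close>. Setting \<open>Y = - y\<^sup>2\<close> absorbs the sign
  \<open>(-1) ^ (wt u div 2)\<close> and gives the identity for all \<open>Y \<le> 0\<close>, hence for polynomials.
\<close>

lemma weight_polynomial_expansion:
  fixes C :: "(bit ^ 'n) set"
  assumes sd: "self_dual C" and n: "CARD('n) = 24 * k + 8"
    and S: "\<And>v. v \<in> half_weight_coset C \<Longrightarrow> 4 * k + 4 \<le> wt v"
  shows "\<exists>d. (\<Sum>u\<in>C. monom (1::real) (wt u div 2))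
     = (\<Sum>j\<le>2 * k. smult (d j) ([:0, 1:] ^ j * [:1, - 1:] ^ (2 * j) * [:1, 1:] ^ (12 * k + 4 - 4 * j)))"
proof -
  define b where "b i = real (card {v \<in> half_weight_coset C. wt v = 4 * i})" for i
  have b_sym: "b i = b (6 * k + 2 - i)" if "i \<le> 6 * k + 2" for i
  proof -
    have "CARD('n) - 4 * i = 4 * (6 * k + 2 - i)" "4 * i \<le> CARD('n)" using that n by auto
    then show ?thesis using half_weight_coset_weight_symmetric[OF sd, of "4 * i"] by (simp only: b_def)
  qed
  have b_low: "b i = 0" if "i \<le> k" for i
  proof -
    have "wt v \<noteq> 4 * i" if "v \<in> half_weight_coset C" for v
      using S[OF that] \<open>i \<le> k\<close> by linarith
    then have "{v \<in> half_weight_coset C. wt v = 4 * i} = {}" by blast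
    then show ?thesis unfolding b_def by (simp only: card.empty of_nat_0)
  qed
  have b_high: "b i = 0" if "i \<ge> 5 * k + 2" "i \<le> 6 * k + 2" for i
    using b_sym[of i] b_low[of "6 * k + 2 - i"] that by simp
  have enum: "(\<Sum>v\<in>half_weight_coset C. x ^ (CARD('n) - wt v) * y ^ wt v)
      = (\<Sum>i\<le>6 * k + 2. b i * (x ^ 4) ^ (6 * k + 2 - i) * (y ^ 4) ^ i)" for x y :: real
  proof -
    have w4: "wt v div 4 = i \<longleftrightarrow> wt v = 4 * i" if "v \<in> half_weight_coset C" for v i
    proof -
      have "wt v mod 4 = 0"
        by (rule half_weight_coset_wt_mod_4[OF sd _ that]) (simp add: n)
      then obtain q where "wt v = 4 * q" by auto
      then show ?thesis by simp
    qed
    have "(\<Sum>v\<in>half_weight_coset C. x ^ (CARD('n) - wt v) * y ^ wt v)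
       = (\<Sum>i\<in>{..6 * k + 2}. \<Sum>v\<in>{v \<in> half_weight_coset C. wt v div 4 = i}. x ^ (CARD('n) - wt v) * y ^ wt v)"
    proof (rule sum.group[symmetric])
      show "(\<lambda>v. wt v div 4) ` half_weight_coset C \<subseteq> {..6 * k + 2}"
      proof
        fix i assume "i \<in> (\<lambda>v. wt v div 4) ` half_weight_coset C"
        then obtain v :: "bit ^ 'n" where "i = wt v div 4" by blast
        then show "i \<in> {..6 * k + 2}" using wt_le[of v] n by simp
      qed
    qed simp_all
    also have "\<dots> = (\<Sum>i\<le>6 * k + 2. b i * (x ^ 4) ^ (6 * k + 2 - i) * (y ^ 4) ^ i)"
    proof (rule sum.cong)
      fix i assume "i \<in> {..6 * k + 2}"
      have "{v \<in> half_weight_coset C. wt v div 4 = i} = {v \<in> half_weight_coset C. wt v = 4 * i}"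
        using w4 by blast
      moreover have "24 * k + 8 - 4 * i = 4 * (6 * k + 2 - i)" by (simp add: diff_mult_distrib2)
      ultimately show "(\<Sum>v\<in>{v \<in> half_weight_coset C. wt v div 4 = i}. x ^ (CARD('n) - wt v) * y ^ wt v)
          = b i * (x ^ 4) ^ (6 * k + 2 - i) * (y ^ 4) ^ i"
        by (simp add: b_def n power_mult)
    qed simp
    finally show ?thesis .
  qed
  \<comment> \<open>The coefficients below \<open>k + 1\<close> and, by symmetry, above \<open>5k + 1\<close> vanish.\<close>
  have trim: "(\<Sum>i\<le>6 * k + 2. b i * x ^ (6 * k + 2 - i) * y ^ i)
      = (x * y) ^ (k + 1) * (\<Sum>i\<le>2 * (2 * k). b (i + (k + 1)) * x ^ (2 * (2 * k) - i) * y ^ i)" for x y :: real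
  proof -
    have "(\<Sum>i\<le>6 * k + 2. b i * x ^ (6 * k + 2 - i) * y ^ i)
       = (\<Sum>i\<in>{k + 1..5 * k + 1}. b i * x ^ (6 * k + 2 - i) * y ^ i)"
    proof (rule sum.mono_neutral_right)
      show "\<forall>i\<in>{..6 * k + 2} - {k + 1..5 * k + 1}. b i * x ^ (6 * k + 2 - i) * y ^ i = 0"
      proof
        fix i assume i: "i \<in> {..6 * k + 2} - {k + 1..5 * k + 1}"
        then have "i \<le> k \<or> (i \<ge> 5 * k + 2 \<and> i \<le> 6 * k + 2)" by auto
        then have "b i = 0" using b_low b_high by blast
        then show "b i * x ^ (6 * k + 2 - i) * y ^ i = 0" by simp
      qed
    qed auto
    also have "\<dots> = (\<Sum>i\<in>{0 + (k + 1)..4 * k + (k + 1)}. b i * x ^ (6 * k + 2 - i) * y ^ i)"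
      by (simp add: algebra_simps)
    also have "\<dots> = (\<Sum>i=0..4 * k. b (i + (k + 1)) * x ^ (6 * k + 2 - (i + (k + 1))) * y ^ (i + (k + 1)))"
      by (rule sum.shift_bounds_cl_nat_ivl)
    also have "\<dots> = (\<Sum>i=0..4 * k. (x * y) ^ (k + 1) * (b (i + (k + 1)) * x ^ (2 * (2 * k) - i) * y ^ i))"
    proof (rule sum.cong)
      fix i assume "i \<in> {0..4 * k}"
      then have "6 * k + 2 - (i + (k + 1)) = (2 * (2 * k) - i) + (k + 1)" by simp
      then show "b (i + (k + 1)) * x ^ (6 * k + 2 - (i + (k + 1))) * y ^ (i + (k + 1))
         = (x * y) ^ (k + 1) * (b (i + (k + 1)) * x ^ (2 * (2 * k) - i) * y ^ i)"
        by (simp only: power_add power_mult_distrib mult_ac)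
    qed simp
    finally show ?thesis by (simp add: sum_distrib_left atLeast0AtMost)
  qed
  have "\<exists>c. \<forall>x y. (\<Sum>i\<le>2 * (2 * k). b (i + (k + 1)) * x ^ (2 * (2 * k) - i) * y ^ i)
           = (\<Sum>j\<le>2 * k. c j * (x * y) ^ (2 * k - j) * (x - y) ^ (2 * j))"
  proof (rule palindromic_form_decomposition)
    fix i assume i: "i \<le> 2 * (2 * k)"
    then have "6 * k + 2 - (i + (k + 1)) = 2 * (2 * k) - i + (k + 1)" by simp
    then show "b (i + (k + 1)) = b (2 * (2 * k) - i + (k + 1))"
      using b_sym[of "i + (k + 1)"] i by simp
  qed
  then obtain c where c: "\<And>x y. (\<Sum>i\<le>2 * (2 * k). b (i + (k + 1)) * x ^ (2 * (2 * k) - i) * y ^ i)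
           = (\<Sum>j\<le>2 * k. c j * (x * y) ^ (2 * k - j) * (x - y) ^ (2 * j))" by blast
  define d where "d j = real (card C) / 2 ^ CARD('n) * c j * (- 64) ^ j" for j
  let ?p = "\<Sum>u\<in>C. monom (1::real) (wt u div 2)"
  let ?q = "\<Sum>j\<le>2 * k. smult (d j) ([:0, 1:] ^ j * [:1, - 1:] ^ (2 * j) * [:1, 1:] ^ (12 * k + 4 - 4 * j))"
  have eval: "poly ?p (- (y\<^sup>2)) = poly ?q (- (y\<^sup>2))" for y :: real
  proof -
    define Y where "Y = - (y\<^sup>2)"
    have "2 ^ CARD('n) * poly ?p Y = (\<Sum>u\<in>C. (-1) ^ (wt u div 2) * 2 ^ (CARD('n) - wt u) * (2 * y) ^ wt u)"
      unfolding poly_sum sum_distrib_left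
    proof (rule sum.cong)
      fix u assume "u \<in> C"
      then obtain m where "wt u = 2 * m" using self_dual_even_wt[OF sd] by (blast elim: evenE)
      then have "y ^ wt u = (y\<^sup>2) ^ (wt u div 2)" by (simp add: power_mult)
      then have "Y ^ (wt u div 2) = (-1) ^ (wt u div 2) * y ^ wt u"
        unfolding Y_def power_minus[of "y\<^sup>2"] by simp
      moreover have "(2::real) ^ CARD('n) = 2 ^ (CARD('n) - wt u) * 2 ^ wt u"
        using wt_le[of u] by (simp flip: power_add)
      ultimately show "2 ^ CARD('n) * poly (monom 1 (wt u div 2)) Y
          = (-1) ^ (wt u div 2) * 2 ^ (CARD('n) - wt u) * (2 * y) ^ wt u"
        by (simp only: poly_monom mult_1 power_mult_distrib mult_ac)
    qed simp
    also have "\<dots> = (\<Sum>u\<in>C. (-1) ^ (wt u div 2) * ((1 + y) + (1 - y)) ^ (CARD('n) - wt u) * ((1 + y) - (1 - y)) ^ wt u)"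
    proof -
      have "(1 + y) + (1 - y) = 2" "(1 + y) - (1 - y) = 2 * y" by simp_all
      then show ?thesis by (simp only:)
    qed
    also have "\<dots> = real (card C) * (\<Sum>v\<in>half_weight_coset C. (1 + y) ^ (CARD('n) - wt v) * (1 - y) ^ wt v)"
      by (rule macwilliams_half_weight_coset[OF sd])
    also have "\<dots> = real (card C) * (((1 + y) ^ 4 * (1 - y) ^ 4) ^ (k + 1) *
        (\<Sum>j\<le>2 * k. c j * ((1 + y) ^ 4 * (1 - y) ^ 4) ^ (2 * k - j) * ((1 + y) ^ 4 - (1 - y) ^ 4) ^ (2 * j)))"
      unfolding enum trim c ..
    also have "(1 + y) ^ 4 * (1 - y) ^ 4 = (1 + Y) ^ 4"
      unfolding Y_def by algebra
    also have "((1 + Y) ^ 4) ^ (k + 1) *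
        (\<Sum>j\<le>2 * k. c j * ((1 + Y) ^ 4) ^ (2 * k - j) * ((1 + y) ^ 4 - (1 - y) ^ 4) ^ (2 * j))
      = (\<Sum>j\<le>2 * k. c j * (- 64) ^ j * (Y ^ j * (1 - Y) ^ (2 * j) * (1 + Y) ^ (12 * k + 4 - 4 * j)))"
      unfolding sum_distrib_left
    proof (rule sum.cong)
      fix j assume "j \<in> {..2 * k}"
      then have "12 * k + 4 - 4 * j = 4 * (k + 1) + 4 * (2 * k - j)" by auto
      then have e1: "(1 + Y) ^ (12 * k + 4 - 4 * j) = ((1 + Y) ^ 4) ^ (k + 1) * ((1 + Y) ^ 4) ^ (2 * k - j)"
        by (simp only: power_add power_mult)
      have "((1 + y) ^ 4 - (1 - y) ^ 4)\<^sup>2 = (- 64) * (Y * (1 - Y)\<^sup>2)"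
        unfolding Y_def by algebra
      then have e2: "((1 + y) ^ 4 - (1 - y) ^ 4) ^ (2 * j) = (- 64) ^ j * (Y ^ j * (1 - Y) ^ (2 * j))"
        by (simp only: power_mult power_mult_distrib)
      show "((1 + Y) ^ 4) ^ (k + 1) * (c j * ((1 + Y) ^ 4) ^ (2 * k - j) * ((1 + y) ^ 4 - (1 - y) ^ 4) ^ (2 * j))
        = c j * (- 64) ^ j * (Y ^ j * (1 - Y) ^ (2 * j) * (1 + Y) ^ (12 * k + 4 - 4 * j))"
        unfolding e1 e2 by (simp only: mult_ac)
    qed simp
    finally have "2 ^ CARD('n) * poly ?p Y = 2 ^ CARD('n) * poly ?q Y"
      by (simp add: poly_sum sum_distrib_left d_def mult_ac)
    then show ?thesis unfolding Y_def by simp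
  qed
  have "?p - ?q = 0"
  proof (rule ccontr)
    assume "?p - ?q \<noteq> 0"
    then have "finite {Y. poly (?p - ?q) Y = 0}" by (rule poly_roots_finite)
    moreover have "{..0} \<subseteq> {Y. poly (?p - ?q) Y = 0}"
    proof
      fix Y :: real assume "Y \<in> {..0}"
      then have "Y = - ((sqrt (- Y))\<^sup>2)" by simp
      then show "Y \<in> {Y. poly (?p - ?q) Y = 0}" using eval[of "sqrt (- Y)"] by simp
    qed
    ultimately show False using infinite_Iic finite_subset by blast
  qed
  then have "?p = ?q" by simp
  then show ?thesis by blast
qed

section \<open>Lagrange inversion\<close>

text \<open>
  With \<open>w = inverse v\<close> and \<open>m = n - i\<close>, the series \<open>deriv ((X v)^i) w^n\<close> equals
  \<open>i X^(i-1) (w^m + X v' w^(m+1))\<close>. For \<open>m > 0\<close> its second part is \<open>- X (w^m)' / m\<close>, whose coefficient at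
  \<open>X^m\<close> cancels that of \<open>w^m\<close>. This is the statement that an exact differential has residue 0.
\<close>

lemma lagrange_summand:
  includes fps_syntax and no vec_syntax
  fixes v :: "'a::field_char_0 fps"
  assumes v: "v $ 0 = 1" and "i \<le> n" "0 < n"
  shows "(fps_deriv ((fps_X * v) ^ i) * inverse v ^ n) $ (n - 1) = (if i = n then of_nat n else 0)"
proof (cases i)
  case 0
  then show ?thesis using assms by auto
next
  case (Suc i')
  define w where "w = inverse v"
  have vw: "v * w = 1"
    unfolding w_def using v by (simp add: inverse_mult_eq_1')
  define m where "m = n - i"
  have n: "n = i' + Suc m" using Suc assms by (simp add: m_def)
  have dw: "fps_deriv w = - (fps_deriv v * w ^ 2)"
    using v by (simp add: w_def fps_inverse_deriv)
  have "fps_deriv ((fps_X * v) ^ i) * w ^ n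
      = of_nat i * (fps_X ^ i' * (v + fps_X * fps_deriv v) * v ^ i' * w ^ n)"
    unfolding Suc fps_deriv_power'
    by (simp add: power_mult_distrib algebra_simps del: of_nat_Suc)
  also have "v ^ i' * w ^ n = w ^ Suc m * (v * w) ^ i'"
    by (simp add: n power_add power_mult_distrib mult_ac)
  then have "of_nat i * (fps_X ^ i' * (v + fps_X * fps_deriv v) * v ^ i' * w ^ n)
     = of_nat i * (fps_X ^ i' * ((v + fps_X * fps_deriv v) * w ^ Suc m))"
    by (simp add: vw mult.assoc)
  also have "(v + fps_X * fps_deriv v) * w ^ Suc m = w ^ m * (v * w) + fps_X * (fps_deriv v * w ^ Suc m)"
    by (simp add: algebra_simps)
  finally have e: "fps_deriv ((fps_X * v) ^ i) * w ^ n
     = of_nat i * (fps_X ^ i' * (w ^ m + fps_X * (fps_deriv v * w ^ Suc m)))"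
    by (simp add: vw)
  have c: "(w ^ m + fps_X * (fps_deriv v * w ^ Suc m)) $ m = (if m = 0 then 1 else 0)"
  proof (cases m)
    case 0
    then show ?thesis by simp
  next
    case (Suc m')
    have "fps_deriv (w ^ m) = - (of_nat m * (fps_deriv v * w ^ Suc m))"
      unfolding fps_deriv_power'[of w m] dw
      by (simp add: Suc power2_eq_square mult_ac del: of_nat_Suc)
    then have "fps_deriv (w ^ m) $ m' = - (of_nat m * (fps_deriv v * w ^ Suc m) $ m')"
      by (simp add: fps_of_nat[symmetric] del: fps_deriv_nth)
    then have "of_nat m * (w ^ m) $ m = - (of_nat m * (fps_deriv v * w ^ Suc m) $ m')"
      by (simp add: Suc del: power_Suc)
    then have "(w ^ m) $ m = - ((fps_deriv v * w ^ Suc m) $ m')"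
      by (metis Suc mult_minus_right mult_left_cancel of_nat_eq_0_iff nat.distinct(1))
    then show ?thesis by (simp add: Suc del: power_Suc)
  qed
  have "(fps_deriv ((fps_X * v) ^ i) * w ^ n) $ (n - 1) = of_nat i * (if m = 0 then 1 else 0)"
    unfolding e using c by (simp add: n fps_of_nat[symmetric] fps_X_power_mult_nth)
  then show ?thesis using assms by (auto simp: w_def m_def)
qed

text \<open>
  Lagrange inversion for an expansion that is only known up to order \<open>L\<close>.
\<close>

lemma lagrange_inversion_truncated:
  includes fps_syntax and no vec_syntax
  fixes v :: "'a::field_char_0 fps"
  assumes v: "v $ 0 = 1" and n: "0 < n" "n \<le> L"
    and F: "\<And>m. m \<le> L \<Longrightarrow> F $ m = (\<Sum>i\<le>L. fps_const (d i) * (fps_X * v) ^ i) $ m"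
  shows "of_nat n * d n = (fps_deriv F * inverse v ^ n) $ (n - 1)"
proof -
  let ?G = "\<Sum>i\<le>n. fps_const (d i) * (fps_X * v) ^ i"
  have G: "F $ m = ?G $ m" if "m \<le> n" for m
  proof -
    have "F $ m = (\<Sum>i\<le>L. (fps_const (d i) * (fps_X * v) ^ i) $ m)"
      using F[of m] that n by (simp add: fps_sum_nth)
    also have "\<dots> = (\<Sum>i\<le>n. (fps_const (d i) * (fps_X * v) ^ i) $ m)"
      by (rule sum.mono_neutral_right) (use that n in \<open>auto simp: power_mult_distrib fps_X_power_mult_nth\<close>)
    finally show ?thesis by (simp add: fps_sum_nth)
  qed
  have "(fps_deriv F * inverse v ^ n) $ (n - 1) = (fps_deriv ?G * inverse v ^ n) $ (n - 1)"
    unfolding fps_mult_nth by (rule sum.cong) (use G n in auto)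
  also have "\<dots> = (\<Sum>i\<le>n. fps_const (d i) * (fps_deriv ((fps_X * v) ^ i) * inverse v ^ n)) $ (n - 1)"
    by (simp add: fps_deriv_sum sum_distrib_right mult.assoc)
  also have "\<dots> = (\<Sum>i\<le>n. d i * (if i = n then of_nat n else 0))"
    unfolding fps_sum_nth by (rule sum.cong) (use lagrange_summand[OF v _ n(1)] in auto)
  also have "\<dots> = of_nat n * d n" by (simp add: if_distrib cong: if_cong)
  finally show ?thesis by simp
qed

lemma geometric_square_power:
  includes fps_syntax and no vec_syntax
  shows "inverse ((1 - fps_X ^ 2) ^ Suc r :: real fps)
    = Abs_fps (\<lambda>m. if even m then real ((m div 2 + r) choose r) else 0)"
proof -
  define E where "E r = Abs_fps (\<lambda>m. if even m then real ((m div 2 + r) choose r) else 0)" for r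
  have E0: "(1 - fps_X ^ 2) * E 0 = 1"
    by (rule fps_ext) (auto simp: E_def left_diff_distrib fps_X_power_mult_nth elim!: evenE)
  have S: "(1 - fps_X ^ 2) * E (Suc r) = E r" for r
  proof (rule fps_ext)
    fix m
    show "((1 - fps_X ^ 2) * E (Suc r)) $ m = E r $ m"
    proof (cases "m < 2")
      case True
      then show ?thesis by (auto simp: E_def left_diff_distrib fps_X_power_mult_nth)
    next
      case False
      then have m: "m = Suc (Suc (m - 2))" by simp
      define m' where "m' = m - 2"
      note m = m[folded m'_def]
      have "(m' div 2 + Suc (Suc r) choose Suc r) = (m' div 2 + Suc r choose r) + (m' div 2 + Suc r choose Suc r)"
        by simp
      then show ?thesis by (simp add: E_def left_diff_distrib fps_X_power_mult_nth m)
    qed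
  qed
  have "(1 - fps_X ^ 2) ^ Suc r * E r = 1"
  proof (induction r)
    case 0
    then show ?case using E0 by simp
  next
    case (Suc r)
    have "(1 - fps_X ^ 2) ^ Suc (Suc r) * E (Suc r) = (1 - fps_X ^ 2) ^ Suc r * ((1 - fps_X ^ 2) * E (Suc r))"
      by (simp add: mult_ac)
    also have "\<dots> = 1" by (simp only: S Suc.IH)
    finally show ?case .
  qed
  then show ?thesis
    unfolding E_def by (rule fps_inverse_unique)
qed

lemma fps_one_plus_X_power_nth:
  includes fps_syntax and no vec_syntax
  shows "(1 + fps_X :: real fps) ^ n $ i = real (n choose i)"
proof -
  have "(1 + fps_X :: real fps) ^ n $ i = fps_binomial (real n) $ i"
    by (simp add: fps_binomial_of_nat)
  then show ?thesis by (simp add: binomial_gbinomial)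
qed

lemma fps_one_minus_X_power_nth:
  includes fps_syntax and no vec_syntax
  shows "(1 - fps_X :: real fps) ^ n $ i = (-1) ^ i * real (n choose i)"
proof -
  have "(1 - fps_X :: real fps) ^ n = (fps_compose (1 + fps_X) (- fps_X)) ^ n"
    by (simp add: fps_compose_add_distrib)
  also have "\<dots> = fps_compose ((1 + fps_X) ^ n) (fps_const (-1) * fps_X)"
    by (subst fps_compose_power) (simp_all flip: fps_const_neg)
  finally show ?thesis
    by (simp add: fps_compose_linear fps_one_plus_X_power_nth del: fps_const_neg)
qed

text \<open>
  If the combination of the Gleason basis with coefficients \<open>d j\<close> is \<open>1\<close> up to order \<open>L\<close>, division by
  \<open>(1 + X)^N\<close> makes \<open>d\<close> the expansion of \<open>(1 + X)^(-N)\<close> in powers of \<open>X v\<close> with \<open>v = (1 - X)\<^sup>2 / (1 + X)^4\<close>.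
  Lagrange inversion then gives \<open>n d n = - N [X^(n-1)] (1 + X)^(4n - N - 1) (1 - X)^(-2n)\<close>. Rewriting the
  series as \<open>(1 + X)^(6n - N - 1) (1 - X\<^sup>2)^(-2n)\<close>, where the hypothesis on \<open>n\<close> makes the first exponent
  nonnegative, avoids alternating signs and leaves a sum with few terms when \<open>6n - N - 1\<close> is small.
\<close>

lemma gleason_coefficient_formula:
  includes fps_syntax and no vec_syntax
  fixes d :: "nat \<Rightarrow> real"
  defines "G \<equiv> \<lambda>N j. fps_X ^ j * (1 - fps_X) ^ (2 * j) * (1 + fps_X) ^ (N - 4 * j)"
  assumes one: "\<And>m. m \<le> L \<Longrightarrow> (\<Sum>j\<le>L. fps_const (d j) * G N j) $ m = (if m = 0 then 1 else 0)"
    and L: "4 * L \<le> N" and n: "n \<le> L" "N + 1 \<le> 6 * n"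
  shows "real n * d n = - real N *
     (\<Sum>i\<le>min (n - 1) (6 * n - (N + 1)). real ((6 * n - (N + 1)) choose i) *
        (if even (n - 1 - i) then real (((n - 1 - i) div 2 + (2 * n - 1)) choose (2 * n - 1)) else 0))"
proof -
  define w z :: "real fps" where "w = inverse (1 + fps_X)" and "z = inverse (1 - fps_X)"
  have w: "(1 + fps_X) * w = 1" and z: "(1 - fps_X) * z = 1"
    by (simp_all add: w_def z_def inverse_mult_eq_1')
  have wz: "w * z = inverse (1 - fps_X ^ 2)"
  proof -
    have "(1 - fps_X ^ 2) * (w * z) = ((1 + fps_X) * w) * ((1 - fps_X) * z)"
      by (simp add: algebra_simps power2_eq_square)
    then show ?thesis using w z by (metis fps_inverse_unique mult_1)
  qed
  define v where "v = (1 - fps_X) ^ 2 * w ^ 4"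
  have v0: "v $ 0 = 1" by (simp add: v_def w_def fps_power_zeroth)
  have iv: "inverse v = z ^ 2 * (1 + fps_X) ^ 4"
  proof (rule fps_inverse_unique)
    have "v * (z ^ 2 * (1 + fps_X) ^ 4) = ((1 - fps_X) * z) ^ 2 * ((1 + fps_X) * w) ^ 4"
      by (simp add: v_def power_mult_distrib mult_ac)
    then show "v * (z ^ 2 * (1 + fps_X) ^ 4) = 1" by (simp add: w z)
  qed
  have Gv: "w ^ N * G N j = (fps_X * v) ^ j" if "j \<le> L" for j
  proof -
    have "w ^ (N - 4 * j) * (w ^ 4) ^ j = w ^ ((N - 4 * j) + 4 * j)"
      by (simp only: power_add power_mult)
    also have "(N - 4 * j) + 4 * j = N" using that L by simp
    finally have wN: "w ^ N = w ^ (N - 4 * j) * (w ^ 4) ^ j" by (rule sym)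
    have "w ^ N * G N j = ((1 + fps_X) * w) ^ (N - 4 * j) * (fps_X * v) ^ j"
      unfolding wN G_def v_def power_mult_distrib power_mult by (simp only: mult_ac)
    then show ?thesis by (simp add: w)
  qed
  have F: "w ^ N $ m = (\<Sum>i\<le>L. fps_const (d i) * (fps_X * v) ^ i) $ m" if m: "m \<le> L" for m
  proof -
    have "(\<Sum>i\<le>L. fps_const (d i) * (fps_X * v) ^ i) = w ^ N * (\<Sum>j\<le>L. fps_const (d j) * G N j)"
      unfolding sum_distrib_left by (rule sum.cong) (use Gv in \<open>auto simp: mult.left_commute\<close>)
    then have "(\<Sum>i\<le>L. fps_const (d i) * (fps_X * v) ^ i) $ m
       = (\<Sum>i=0..m. w ^ N $ i * (if m - i = 0 then 1 else 0))"
      using one m by (simp only: fps_mult_nth) 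
    also have "\<dots> = (\<Sum>i=0..m. if i = m then w ^ N $ i else 0)"
      by (rule sum.cong) auto
    finally show ?thesis by simp
  qed
  have n0: "0 < n" using n by (cases n) auto
  define e where "e = 6 * n - (N + 1)"
  have "real n * d n = (fps_deriv (w ^ N) * inverse v ^ n) $ (n - 1)"
    using lagrange_inversion_truncated[OF v0 n0 n(1) F] by simp
  also have "fps_deriv (w ^ N) = - (of_nat N * w ^ (N + 1))"
  proof -
    have dw: "fps_deriv w = - (w ^ 2)"
      by (simp add: w_def fps_inverse_deriv)
    show ?thesis
      unfolding fps_deriv_power'[of w N] dw
      by (cases N) (simp_all add: power2_eq_square mult_ac del: of_nat_Suc)
  qed
  also have "- (of_nat N * w ^ (N + 1)) * inverse v ^ n
     = - (of_nat N * ((1 + fps_X) ^ e * inverse ((1 - fps_X ^ 2) ^ Suc (2 * n - 1))))"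
  proof -
    let ?p = "1 + fps_X :: real fps"
    \<comment> \<open>As \<open>w\<close> inverts \<open>?p\<close>, only the difference of the two exponents matters.\<close>
    have sh: "?p ^ a * w ^ b = ?p ^ a' * w ^ b'" if "a + b' = a' + b" for a b a' b'
    proof -
      have c: "?p ^ a * w ^ b * ?p ^ (b + b') = ?p ^ (a + b')"
        using arg_cong[OF w, of "\<lambda>x. x ^ b"] by (simp add: power_mult_distrib power_add mult_ac)
      have c': "?p ^ a' * w ^ b' * ?p ^ (b + b') = ?p ^ (a' + b)"
        using arg_cong[OF w, of "\<lambda>x. x ^ b'"] by (simp add: power_mult_distrib power_add mult_ac)
      have "?p \<noteq> 0"
        using w by auto
      then show ?thesis using c c' that by (metis mult_right_cancel power_not_zero)
    qed
    have "w ^ (N + 1) * inverse v ^ n = (?p ^ (4 * n) * w ^ (N + 1)) * z ^ (2 * n)"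
      unfolding iv power_mult_distrib power_mult by (simp only: mult_ac)
    also have "?p ^ (4 * n) * w ^ (N + 1) = ?p ^ e * w ^ (2 * n)"
      by (rule sh) (use n in \<open>simp add: e_def\<close>)
    also have "?p ^ e * w ^ (2 * n) * z ^ (2 * n) = ?p ^ e * (w * z) ^ (2 * n)"
      by (simp add: power_mult_distrib mult_ac)
    also have "(w * z) ^ (2 * n) = inverse ((1 - fps_X ^ 2) ^ Suc (2 * n - 1))"
      using n0 by (simp add: wz fps_inverse_power)
    finally show ?thesis by (simp add: mult.assoc)
  qed
  also have "(- (of_nat N * ((1 + fps_X) ^ e * inverse ((1 - fps_X ^ 2) ^ Suc (2 * n - 1))))) $ (n - 1)
    = - real N * (\<Sum>i=0..n-1. real (e choose i) *
        (if even (n - 1 - i) then real (((n - 1 - i) div 2 + (2 * n - 1)) choose (2 * n - 1)) else 0))"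
  proof -
    have "(of_nat N * f :: real fps) $ m = real N * f $ m" for f m
      by (simp flip: fps_of_nat)
    then show ?thesis
      unfolding geometric_square_power fps_neg_nth
      by (simp only: fps_mult_nth[of "(1 + fps_X) ^ e"] fps_one_plus_X_power_nth fps_nth_Abs_fps mult_minus_left)
  qed
  also have "(\<Sum>i=0..n-1. real (e choose i) *
        (if even (n - 1 - i) then real (((n - 1 - i) div 2 + (2 * n - 1)) choose (2 * n - 1)) else 0))
     = (\<Sum>i\<le>min (n - 1) e. real (e choose i) *
        (if even (n - 1 - i) then real (((n - 1 - i) div 2 + (2 * n - 1)) choose (2 * n - 1)) else 0))"
    by (rule sum.mono_neutral_right) auto
  finally show ?thesis by (simp add: e_def)
qed

section \<open>The sign of one coefficient\<close>

text \<open>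
  Writes binomial coefficients near \<open>A choose B\<close> as polynomial multiples of a common quantity, so that linear
  inequalities between them become polynomial inequalities.
\<close>

lemma binomial_shift:
  fixes A B K a b :: nat
  assumes AB: "A = B + K + 5" and ab: "b \<le> 5" "a \<le> b + 1"
  shows "real ((A + a) choose (B + b)) * (fact (B + 5) * fact (K + 6)) =
     fact A * (pochhammer (real A + 1) a * pochhammer (real B + b + 1) (5 - b)
        * pochhammer (real K + 6 + a - b) (b + 1 - a))"
proof -
  have f: "fact (p + q) = fact p * pochhammer (real p + 1) q" for p q
    unfolding pochhammer_fact[of "p + q"] pochhammer_product'[of "1::real"] pochhammer_fact
    by (simp add: add.commute)
  have "real ((A + a) choose (B + b)) * (fact (B + b) * fact (K + 5 + a - b)) = fact (A + a)"
  proof -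
    have "A + a - (B + b) = K + 5 + a - b" using AB ab by simp
    then show ?thesis
      using binomial_fact_lemma[of "B + b" "A + a"] AB ab
      by (simp add: binomial_fact)
  qed
  moreover have "fact (A + a) = fact A * pochhammer (real A + 1) a" by (rule f)
  moreover have "fact (B + 5) = fact (B + b) * pochhammer (real B + b + 1) (5 - b)"
    using f[of "B + b" "5 - b"] ab by simp
  moreover have "fact (K + 6) = fact (K + 5 + a - b) * pochhammer (real K + 6 + a - b) (b + 1 - a)"
  proof -
    have "real (K + 5 + a - b) + 1 = real K + 6 + a - b" "(K + 5 + a - b) + (b + 1 - a) = K + 6"
      using ab by (simp_all add: of_nat_diff)
    then show ?thesis using f[of "K + 5 + a - b" "b + 1 - a"] by (simp only:)
  qed
  ultimately show ?thesis by (simp add: mult_ac)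
qed

lemma pochhammer_small:
  fixes x :: real
  shows "pochhammer x 1 = x" "pochhammer x (Suc 0) = x"
    "pochhammer x 2 = x * (x + 1)" "pochhammer x 3 = x * (x + 1) * (x + 2)"
    "pochhammer x 4 = x * (x + 1) * (x + 2) * (x + 3)"
    "pochhammer x 5 = x * (x + 1) * (x + 2) * (x + 3) * (x + 4)"
    "pochhammer x 6 = x * (x + 1) * (x + 2) * (x + 3) * (x + 4) * (x + 5)"
  by (simp_all add: pochhammer_Suc eval_nat_numeral add_ac)

text \<open>
  The three sums are the values of \<open>gleason_coefficient_formula\<close> at \<open>n = 2k + 1\<close>, \<open>2k + 2\<close>, \<open>2k + 3\<close>, with exponents
  \<open>6n - N - 1 = 1\<close>, \<open>7\<close>, \<open>13\<close>; their numerical factors are the binomial coefficients of 7 with odd and of 13 with even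
  lower index. After removal of a common positive factor the difference of the two sides is a polynomial of
  degree 9 in \<open>k\<close>, and in the variable \<open>x = k - 137\<close> all its coefficients are positive.
\<close>

lemma third_coefficient_inequality:
  fixes k :: nat
  assumes "137 \<le> k"
  defines "S1 \<equiv> real ((5 * k + 1) choose (4 * k + 1))"
    and "S2 \<equiv> 7 * real ((5 * k + 3) choose (4 * k + 3)) + 35 * real ((5 * k + 2) choose (4 * k + 3))
       + 21 * real ((5 * k + 1) choose (4 * k + 3)) + real ((5 * k) choose (4 * k + 3))"
    and "S3 \<equiv> real ((5 * k + 6) choose (4 * k + 5)) + 78 * real ((5 * k + 5) choose (4 * k + 5))
       + 715 * real ((5 * k + 4) choose (4 * k + 5)) + 1716 * real ((5 * k + 3) choose (4 * k + 5))
       + 1287 * real ((5 * k + 2) choose (4 * k + 5)) + 286 * real ((5 * k + 1) choose (4 * k + 5))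
       + 13 * real ((5 * k) choose (4 * k + 5))"
  shows "S3 * (2 * real k + 2) * (2 * real k + 1)
    < 8 * S2 * (2 * real k + 3) * (2 * real k + 1)
     + (4 * real k - 1) * S1 * (2 * real k + 3) * (2 * real k + 2)"
proof -
  define m where "m = k - 137"
  have k: "k = m + 137" using assms by (simp add: m_def)
  define x where "x = real m"
  have rk: "real k = x + 137" by (simp add: k x_def)
  have x: "0 \<le> x" by (simp add: x_def)
  \<comment> \<open>Every binomial coefficient below is \<open>F / D\<close> times a polynomial in \<open>x\<close>.\<close>
  define D F :: real where "D = fact (4 * k + 5) * fact ((m + 132) + 6)" and "F = fact (5 * k)"
  have D: "D > 0" and F: "F > 0" by (simp_all add: D_def F_def)
  have b: "real ((5 * k + a) choose (4 * k + b)) * D =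
     F * (pochhammer (5 * x + 686) a * pochhammer (4 * x + 549 + b) (5 - b)
        * pochhammer (x + 138 + a - b) (b + 1 - a))" if "b \<le> 5" "a \<le> b + 1" for a b
  proof -
    have e: "5 * k = 4 * k + (m + 132) + 5" by (simp add: k)
    have "real (5 * k) + 1 = 5 * x + 686" "real (4 * k) + real b + 1 = 4 * x + 549 + b"
      "real (m + 132) + 6 + a - b = x + 138 + a - b" by (simp_all add: k x_def)
    then show ?thesis
      using binomial_shift[OF e that] by (simp only: D_def F_def)
  qed
  have t11: "real ((5 * k + 1) choose (4 * k + 1)) * D = F * ((5 * x + 686) * (4 * x + 550) * (4 * x + 551) * (4 * x + 552) * (4 * x + 553) * (x + 138))"
    using b[of 1 1] by (simp add: pochhammer_small add_ac mult_ac)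
  have t33: "real ((5 * k + 3) choose (4 * k + 3)) * D = F * ((5 * x + 686) * (5 * x + 687) * (5 * x + 688) * (4 * x + 552) * (4 * x + 553) * (x + 138))"
    using b[of 3 3] by (simp add: pochhammer_small add_ac mult_ac)
  have t23: "real ((5 * k + 2) choose (4 * k + 3)) * D = F * ((5 * x + 686) * (5 * x + 687) * (4 * x + 552) * (4 * x + 553) * (x + 137) * (x + 138))"
    using b[of 3 2] by (simp add: pochhammer_small add_ac mult_ac)
  have t13: "real ((5 * k + 1) choose (4 * k + 3)) * D = F * ((5 * x + 686) * (4 * x + 552) * (4 * x + 553) * (x + 136) * (x + 137) * (x + 138))"
    using b[of 3 1] by (simp add: pochhammer_small add_ac mult_ac)
  have t03: "real ((5 * k) choose (4 * k + 3)) * D = F * ((4 * x + 552) * (4 * x + 553) * (x + 135) * (x + 136) * (x + 137) * (x + 138))"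
    using b[of 3 0] by (simp add: pochhammer_small add_ac mult_ac)
  have t65: "real ((5 * k + 6) choose (4 * k + 5)) * D = F * ((5 * x + 686) * (5 * x + 687) * (5 * x + 688) * (5 * x + 689) * (5 * x + 690) * (5 * x + 691))"
    using b[of 5 6] by (simp add: pochhammer_small add_ac mult_ac)
  have t55: "real ((5 * k + 5) choose (4 * k + 5)) * D = F * ((5 * x + 686) * (5 * x + 687) * (5 * x + 688) * (5 * x + 689) * (5 * x + 690) * (x + 138))"
    using b[of 5 5] by (simp add: pochhammer_small add_ac mult_ac)
  have t45: "real ((5 * k + 4) choose (4 * k + 5)) * D = F * ((5 * x + 686) * (5 * x + 687) * (5 * x + 688) * (5 * x + 689) * (x + 137) * (x + 138))"
    using b[of 5 4] by (simp add: pochhammer_small add_ac mult_ac)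
  have t35: "real ((5 * k + 3) choose (4 * k + 5)) * D = F * ((5 * x + 686) * (5 * x + 687) * (5 * x + 688) * (x + 136) * (x + 137) * (x + 138))"
    using b[of 5 3] by (simp add: pochhammer_small add_ac mult_ac)
  have t25: "real ((5 * k + 2) choose (4 * k + 5)) * D = F * ((5 * x + 686) * (5 * x + 687) * (x + 135) * (x + 136) * (x + 137) * (x + 138))"
    using b[of 5 2] by (simp add: pochhammer_small add_ac mult_ac)
  have t15: "real ((5 * k + 1) choose (4 * k + 5)) * D = F * ((5 * x + 686) * (x + 134) * (x + 135) * (x + 136) * (x + 137) * (x + 138))"
    using b[of 5 1] by (simp add: pochhammer_small add_ac mult_ac)
  have t05: "real ((5 * k) choose (4 * k + 5)) * D = F * ((x + 133) * (x + 134) * (x + 135) * (x + 136) * (x + 137) * (x + 138))"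
    using b[of 5 0] by (simp add: pochhammer_small add_ac mult_ac)
  define T1 T2 T3 where "T1 = (5 * x + 686) * (4 * x + 550) * (4 * x + 551) * (4 * x + 552) * (4 * x + 553) * (x + 138)"
    and "T2 = 7 * ((5 * x + 686) * (5 * x + 687) * (5 * x + 688) * (4 * x + 552) * (4 * x + 553) * (x + 138))
      + 35 * ((5 * x + 686) * (5 * x + 687) * (4 * x + 552) * (4 * x + 553) * (x + 137) * (x + 138))
      + 21 * ((5 * x + 686) * (4 * x + 552) * (4 * x + 553) * (x + 136) * (x + 137) * (x + 138))
      + 1 * ((4 * x + 552) * (4 * x + 553) * (x + 135) * (x + 136) * (x + 137) * (x + 138))"
    and "T3 = 1 * ((5 * x + 686) * (5 * x + 687) * (5 * x + 688) * (5 * x + 689) * (5 * x + 690) * (5 * x + 691))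
      + 78 * ((5 * x + 686) * (5 * x + 687) * (5 * x + 688) * (5 * x + 689) * (5 * x + 690) * (x + 138))
      + 715 * ((5 * x + 686) * (5 * x + 687) * (5 * x + 688) * (5 * x + 689) * (x + 137) * (x + 138))
      + 1716 * ((5 * x + 686) * (5 * x + 687) * (5 * x + 688) * (x + 136) * (x + 137) * (x + 138))
      + 1287 * ((5 * x + 686) * (5 * x + 687) * (x + 135) * (x + 136) * (x + 137) * (x + 138))
      + 286 * ((5 * x + 686) * (x + 134) * (x + 135) * (x + 136) * (x + 137) * (x + 138))
      + 13 * ((x + 133) * (x + 134) * (x + 135) * (x + 136) * (x + 137) * (x + 138))"
  have S1: "S1 * D = F * T1"
    unfolding S1_def T1_def by (rule t11)
  have "S2 * D = 7 * (real ((5 * k + 3) choose (4 * k + 3)) * D) + 35 * (real ((5 * k + 2) choose (4 * k + 3)) * D) + 21 * (real ((5 * k + 1) choose (4 * k + 3)) * D) + 1 * (real ((5 * k) choose (4 * k + 3)) * D)"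
    by (simp add: S2_def distrib_right)
  also have "\<dots> = F * T2"
    unfolding t33 t23 t13 t03 T2_def by algebra
  finally have S2: "S2 * D = F * T2" .
  have "S3 * D = 1 * (real ((5 * k + 6) choose (4 * k + 5)) * D) + 78 * (real ((5 * k + 5) choose (4 * k + 5)) * D) + 715 * (real ((5 * k + 4) choose (4 * k + 5)) * D) + 1716 * (real ((5 * k + 3) choose (4 * k + 5)) * D) + 1287 * (real ((5 * k + 2) choose (4 * k + 5)) * D) + 286 * (real ((5 * k + 1) choose (4 * k + 5)) * D) + 13 * (real ((5 * k) choose (4 * k + 5)) * D)"
    by (simp add: S3_def distrib_right)
  also have "\<dots> = F * T3"
    unfolding t65 t55 t45 t35 t25 t15 t05 T3_def by algebra
  finally have S3: "S3 * D = F * T3" .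
  let ?P = "970066946081372832000 + x * (2665069388301364220160 + x * (153270400158295581696
     + x * (3887253716167730368 + x * (56449640406506736 + x * (512754214477632
     + x * (2982032137536 + x * (10841650944 + x * (22526976 + x * 20480))))))))"
  have "8 * T2 * (2 * x + 277) * (2 * x + 275) + (4 * x + 547) * T1 * (2 * x + 277) * (2 * x + 276)
     - T3 * (2 * x + 276) * (2 * x + 275) = ?P"
    unfolding T1_def T2_def T3_def by algebra
  moreover have "?P > 0" using x by (intro add_pos_nonneg mult_nonneg_nonneg add_nonneg_nonneg) auto
  ultimately have "F * (T3 * (2 * x + 276) * (2 * x + 275))
      < F * (8 * T2 * (2 * x + 277) * (2 * x + 275) + (4 * x + 547) * T1 * (2 * x + 277) * (2 * x + 276))"
    using F by (intro mult_strict_left_mono) auto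
  then have "(F * T3) * ((2 * x + 276) * (2 * x + 275))
     < 8 * (F * T2) * ((2 * x + 277) * (2 * x + 275)) + (F * T1) * ((4 * x + 547) * (2 * x + 277) * (2 * x + 276))"
    by (simp add: distrib_left mult_ac)
  then have "(S3 * ((2 * x + 276) * (2 * x + 275))) * D
     < (8 * S2 * ((2 * x + 277) * (2 * x + 275)) + S1 * ((4 * x + 547) * (2 * x + 277) * (2 * x + 276))) * D"
    unfolding S1[symmetric] S2[symmetric] S3[symmetric] by (simp add: algebra_simps)
  then have "S3 * ((2 * x + 276) * (2 * x + 275))
     < 8 * S2 * ((2 * x + 277) * (2 * x + 275)) + S1 * ((4 * x + 547) * (2 * x + 277) * (2 * x + 276))"
    using D mult_less_cancel_right_pos by blast
  moreover have "2 * real k + 1 = 2 * x + 275" "2 * real k + 2 = 2 * x + 276"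
    "2 * real k + 3 = 2 * x + 277" "4 * real k - 1 = 4 * x + 547" by (simp_all add: rk)
  ultimately show ?thesis by (simp only: mult_ac)
qed

lemma gleason_term_nth:
  includes fps_syntax and no vec_syntax
  fixes j a b :: nat
  defines "G \<equiv> fps_X ^ j * (1 - fps_X) ^ a * (1 + fps_X) ^ b :: real fps"
  shows "m < j \<Longrightarrow> G $ m = 0" "G $ j = 1" "G $ (j + 1) = real b - real a"
    "G $ (j + 2) = real (a choose 2) - real a * real b + real (b choose 2)"
  unfolding G_def
  by (simp_all add: mult.assoc fps_X_power_mult_nth fps_mult_nth[of "(1 - fps_X) ^ a"]
      fps_one_plus_X_power_nth fps_one_minus_X_power_nth eval_nat_numeral)

text \<open>
  \<open>P\<close> is a combination of the first \<open>2k + 1\<close> Gleason basis elements that agrees with \<open>1\<close> up to order \<open>2k\<close>.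
  Since \<open>G j\<close> starts with \<open>X^j\<close>, three further basis elements correct its next three coefficients to zero, and Lagrange
  inversion gives the factors \<open>d1\<close>, \<open>d2\<close>, \<open>d3\<close> of these three elements. Solving for the third coefficient that was
  corrected expresses it through them.
\<close>

lemma gleason_third_coefficient_negative:
  includes fps_syntax and no vec_syntax
  fixes k :: nat and d :: "nat \<Rightarrow> real"
  defines "G \<equiv> \<lambda>j. fps_X ^ j * (1 - fps_X) ^ (2 * j) * (1 + fps_X) ^ (12 * k + 4 - 4 * j) :: real fps"
  defines "P \<equiv> \<Sum>j\<le>2 * k. fps_const (d j) * G j"
  assumes k: "137 \<le> k" and P0: "P $ 0 = 1" and P1: "\<And>i. 0 < i \<Longrightarrow> i \<le> 2 * k \<Longrightarrow> P $ i = 0"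
  shows "P $ (2 * k + 3) < 0"
proof -
  have G1: "G (2*k+1) $ m = 0" if "m < 2*k+1" for m
    using gleason_term_nth(1)[OF that] unfolding G_def .
  have G2: "G (2*k+2) $ m = 0" if "m < 2*k+2" for m
    using gleason_term_nth(1)[OF that] unfolding G_def .
  have G3: "G (2*k+3) $ m = 0" if "m < 2*k+3" for m
    using gleason_term_nth(1)[OF that] unfolding G_def .
  have G10: "G (2*k+1) $ (2*k+1) = 1" and G20: "G (2*k+2) $ (2*k+2) = 1" and G30: "G (2*k+3) $ (2*k+3) = 1"
    unfolding G_def by (rule gleason_term_nth(2))+
  have G11: "G (2*k+1) $ (2*k+2) = - 2"
  proof -
    have e: "12 * k + 4 - 4 * (2 * k + 1) = 4 * k" "2 * k + 1 + 1 = 2 * k + 2" by simp_all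
    have "G (2*k+1) $ (2*k+2) = real (4 * k) - real (2 * (2 * k + 1))"
      using gleason_term_nth(3)[of "2*k+1"] unfolding G_def by (simp only: e)
    then show ?thesis by simp
  qed
  have G21: "G (2*k+2) $ (2*k+3) = - 8"
  proof -
    have e: "12 * k + 4 - 4 * (2 * k + 2) = 4 * k - 4" "2 * k + 2 + 1 = 2 * k + 3" by simp_all
    have "G (2*k+2) $ (2*k+3) = real (4 * k - 4) - real (2 * (2 * k + 2))"
      using gleason_term_nth(3)[of "2*k+2"] unfolding G_def by (simp only: e)
    then show ?thesis using k by (simp add: of_nat_diff)
  qed
  have G12: "G (2*k+1) $ (2*k+3) = 1 - 4 * real k"
  proof -
    have ch: "real (n choose 2) = real n * (real n - 1) / 2" for n
      by (induction n) (simp_all add: eval_nat_numeral field_simps)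
    have e: "12 * k + 4 - 4 * (2 * k + 1) = 4 * k" "2 * k + 1 + 2 = 2 * k + 3" by simp_all
    have "G (2*k+1) $ (2*k+3) = real ((2 * (2 * k + 1)) choose 2)
       - real (2 * (2 * k + 1)) * real (4 * k) + real ((4 * k) choose 2)"
      using gleason_term_nth(4)[of "2*k+1"] unfolding G_def by (simp only: e)
    then show ?thesis unfolding ch by (simp add: field_simps)
  qed
  define L where "L = 2 * k + 3"
  \<comment> \<open>The correcting coefficients, from the expansions of \<open>G (2k+1)\<close> and \<open>G (2k+2)\<close> just computed.\<close>
  define d1 where "d1 = - P $ (2*k+1)"
  define d2 where "d2 = 2 * d1 - P $ (2*k+2)"
  define d3 where "d3 = - P $ (2*k+3) + 8 * d2 + (4 * real k - 1) * d1"
  define d' where "d' = d(2*k+1 := d1, 2*k+2 := d2, 2*k+3 := d3)"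
  have d': "d' (2*k+1) = d1" "d' (2*k+2) = d2" "d' (2*k+3) = d3" by (simp_all add: d'_def)
  have split: "(\<Sum>j\<le>L. fps_const (d' j) * G j) = P + fps_const d1 * G (2*k+1)
      + fps_const d2 * G (2*k+2) + fps_const d3 * G (2*k+3)"
  proof -
    have L': "L = Suc (Suc (Suc (2 * k)))" by (simp add: L_def)
    have s: "Suc (2*k) = 2*k+1" "Suc (2*k+1) = 2*k+2" "Suc (2*k+2) = 2*k+3" by simp_all
    have "(\<Sum>j\<le>2*k. fps_const (d' j) * G j) = P"
      unfolding P_def by (rule sum.cong) (auto simp: d'_def)
    then show ?thesis unfolding L' sum.atMost_Suc unfolding s d' by (simp only:)
  qed
  have one: "(\<Sum>j\<le>L. fps_const (d' j) * G j) $ m = (if m = 0 then 1 else 0)" if "m \<le> L" for m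
  proof -
    have "m = 0 \<or> (0 < m \<and> m \<le> 2*k) \<or> m = 2*k+1 \<or> m = 2*k+2 \<or> m = 2*k+3"
      using that unfolding L_def by linarith
    then consider "m = 0" | "0 < m" "m \<le> 2*k" | "m = 2*k+1" | "m = 2*k+2" | "m = 2*k+3"
      by blast
    then show ?thesis
    proof cases
      case 1
      then show ?thesis using G1[of m] G2[of m] G3[of m] P0 unfolding split by simp
    next
      case 2
      then show ?thesis using G1[of m] G2[of m] G3[of m] P1[of m] unfolding split by simp
    next
      case 3
      then show ?thesis using G10 G2[of m] G3[of m] unfolding split by (simp add: d1_def)
    next
      case 4
      then show ?thesis using G11 G20 G3[of m] unfolding split by (simp add: d2_def)
    next
      case 5
      then show ?thesis unfolding split 5 fps_add_nth fps_mult_left_const_nth G12 G21 G30 d3_def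
        by (simp add: algebra_simps)
    qed
  qed
  have "4 * L \<le> 12 * k + 4" using k by (simp add: L_def)
  note lag = gleason_coefficient_formula[OF one[unfolded G_def] this]
  define N where "N = 12 * real k + 4"
  define S1 where "S1 = real ((5 * k + 1) choose (4 * k + 1))"
  define S2 where "S2 = 7 * real ((5 * k + 3) choose (4 * k + 3)) + 35 * real ((5 * k + 2) choose (4 * k + 3))
       + 21 * real ((5 * k + 1) choose (4 * k + 3)) + real ((5 * k) choose (4 * k + 3))"
  define S3 where "S3 = real ((5 * k + 6) choose (4 * k + 5)) + 78 * real ((5 * k + 5) choose (4 * k + 5))
       + 715 * real ((5 * k + 4) choose (4 * k + 5)) + 1716 * real ((5 * k + 3) choose (4 * k + 5))
       + 1287 * real ((5 * k + 2) choose (4 * k + 5)) + 286 * real ((5 * k + 1) choose (4 * k + 5))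
       + 13 * real ((5 * k) choose (4 * k + 5))"
  have min: "min (2*k+1 - 1) 1 = 1" "6 * (2*k+1) - (12*k+4+1) = 1"
    "min (2*k+2 - 1) 7 = 7" "6 * (2*k+2) - (12*k+4+1) = 7"
    "min (2*k+3 - 1) 13 = 13" "6 * (2*k+3) - (12*k+4+1) = 13"
    using k by simp_all
  have rN: "real (12 * k + 4) = N" by (simp add: N_def)
  define l where "l = k - 10"
  have kl: "k = l + 10" using k by (simp add: l_def)
  have "real (2*k+1) * d1 = - N * S1"
  proof -
    have "real (2*k+1) * d1 = - N * (\<Sum>i\<le>1. real (1 choose i) *
        (if even (2*k+1 - 1 - i) then real (((2*k+1 - 1 - i) div 2 + (2 * (2*k+1) - 1)) choose (2 * (2*k+1) - 1)) else 0))"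
      by (rule lag[of "2*k+1", unfolded min rN d' L_def]) simp_all
    also have "(\<Sum>i\<le>1. real (1 choose i) *
        (if even (2*k+1 - 1 - i) then real (((2*k+1 - 1 - i) div 2 + (2 * (2*k+1) - 1)) choose (2 * (2*k+1) - 1)) else 0)) = S1"
      unfolding S1_def kl by (simp add: algebra_simps)
    finally show ?thesis .
  qed
  moreover have "real (2*k+2) * d2 = - N * S2"
  proof -
    have b: "7 choose 0 = (1::nat)" "7 choose 1 = (7::nat)" "7 choose 2 = (21::nat)" "7 choose 3 = (35::nat)"
       "7 choose 4 = (35::nat)" "7 choose 5 = (21::nat)" "7 choose 6 = (7::nat)" "7 choose 7 = (1::nat)"
      by (simp_all add: eval_nat_numeral)
    have s: "(\<Sum>i\<le>7. f i) = f 0 + f 1 + f 2 + f 3 + f 4 + f 5 + f 6 + f 7" for f :: "nat \<Rightarrow> real"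
      by (simp add: eval_nat_numeral)
    have "real (2*k+2) * d2 = - N * (\<Sum>i\<le>7. real (7 choose i) *
        (if even (2*k+2 - 1 - i) then real (((2*k+2 - 1 - i) div 2 + (2 * (2*k+2) - 1)) choose (2 * (2*k+2) - 1)) else 0))"
      by (rule lag[of "2*k+2", unfolded min rN d' L_def]) simp_all
    also have "(\<Sum>i\<le>7. real (7 choose i) *
        (if even (2*k+2 - 1 - i) then real (((2*k+2 - 1 - i) div 2 + (2 * (2*k+2) - 1)) choose (2 * (2*k+2) - 1)) else 0)) = S2"
      unfolding S2_def kl s b by (simp add: algebra_simps)
    finally show ?thesis .
  qed
  moreover have "real (2*k+3) * d3 = - N * S3"
  proof -
    have b: "13 choose 0 = (1::nat)" "13 choose 1 = (13::nat)" "13 choose 2 = (78::nat)" "13 choose 3 = (286::nat)"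
       "13 choose 4 = (715::nat)" "13 choose 5 = (1287::nat)" "13 choose 6 = (1716::nat)" "13 choose 7 = (1716::nat)"
       "13 choose 8 = (1287::nat)" "13 choose 9 = (715::nat)" "13 choose 10 = (286::nat)" "13 choose 11 = (78::nat)"
       "13 choose 12 = (13::nat)" "13 choose 13 = (1::nat)"
      by (simp_all add: eval_nat_numeral)
    have s: "(\<Sum>i\<le>13. f i) = f 0 + f 1 + f 2 + f 3 + f 4 + f 5 + f 6 + f 7 + f 8 + f 9 + f 10
        + f 11 + f 12 + f 13" for f :: "nat \<Rightarrow> real"
      by (simp add: eval_nat_numeral)
    have "real (2*k+3) * d3 = - N * (\<Sum>i\<le>13. real (13 choose i) *
        (if even (2*k+3 - 1 - i) then real (((2*k+3 - 1 - i) div 2 + (2 * (2*k+3) - 1)) choose (2 * (2*k+3) - 1)) else 0))"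
      by (rule lag[of "2*k+3", unfolded min rN d' L_def]) simp_all
    also have "(\<Sum>i\<le>13. real (13 choose i) *
        (if even (2*k+3 - 1 - i) then real (((2*k+3 - 1 - i) div 2 + (2 * (2*k+3) - 1)) choose (2 * (2*k+3) - 1)) else 0)) = S3"
      unfolding S3_def kl s b by (simp add: algebra_simps)
    finally show ?thesis .
  qed
  ultimately have dd: "d1 = - N * S1 / (2 * real k + 1)" "d2 = - N * S2 / (2 * real k + 2)"
    "d3 = - N * S3 / (2 * real k + 3)"
    by (simp_all add: field_simps)
  let ?a = "2 * real k + 1" and ?b = "2 * real k + 2" and ?c = "2 * real k + 3"
  have "P $ (2*k+3) = - d3 + 8 * d2 + (4 * real k - 1) * d1" by (simp add: d3_def)
  also have "\<dots> = N * (S3 * ?b * ?a - (8 * S2 * ?c * ?a + (4 * real k - 1) * S1 * ?c * ?b)) / (?a * ?b * ?c)"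
    unfolding dd by (simp add: divide_simps) (simp add: algebra_simps)
  also have "\<dots> < 0"
    using third_coefficient_inequality[OF k, folded S1_def S2_def S3_def]
    by (intro divide_neg_pos mult_pos_neg) (auto simp: N_def intro!: mult_pos_pos add_nonneg_pos)
  finally show ?thesis .
qed

text \<open>
  The coefficient of \<open>Y^(2k+3)\<close> in the weight polynomial counts the codewords of weight \<open>4k + 6\<close>.
\<close>

lemma no_self_dual_code_with_long_shadow:
  fixes C :: "(bit ^ 'n) set"
  assumes k: "137 \<le> k" and n: "CARD('n) = 24 * k + 8" and sd: "self_dual C"
    and d: "\<And>u. u \<in> C \<Longrightarrow> u \<noteq> 0 \<Longrightarrow> 4 * k + 2 \<le> wt u"
    and S: "\<And>v. v \<in> half_weight_coset C \<Longrightarrow> 4 * k + 4 \<le> wt v"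
  shows False
proof -
  obtain c where c: "(\<Sum>u\<in>C. monom (1::real) (wt u div 2))
     = (\<Sum>j\<le>2 * k. smult (c j) ([:0, 1:] ^ j * [:1, - 1:] ^ (2 * j) * [:1, 1:] ^ (12 * k + 4 - 4 * j)))"
    using weight_polynomial_expansion[OF sd n S] by blast
  define F where "F = (\<Sum>j\<le>2 * k. fps_const (c j) *
      (fps_X ^ j * (1 - fps_X) ^ (2 * j) * (1 + fps_X) ^ (12 * k + 4 - 4 * j)))"
  have minus: "1 + fps_const (- 1) * fps_X = (1 - fps_X :: real fps)"
    by (simp flip: fps_const_neg)
  have "fps_of_poly (\<Sum>u\<in>C. monom (1::real) (wt u div 2)) = F"
    unfolding c F_def
    by (simp add: fps_of_poly_sum fps_of_poly_smult fps_of_poly_mult fps_of_poly_power fps_of_poly_linear' minus)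
  then have F_coeff: "fps_nth F i = coeff (\<Sum>u\<in>C. monom (1::real) (wt u div 2)) i" for i
    by (simp only: flip: fps_of_poly_nth)
  have F: "fps_nth F i = real (card {u \<in> C. wt u div 2 = i})" for i
    unfolding F_coeff by (simp add: coeff_sum flip: sum.inter_filter)
  have small: "{u \<in> C. wt u div 2 = i} = (if i = 0 then {0} else {})" if "i \<le> 2 * k" for i
  proof -
    have only_0: "u = 0 \<and> i = 0" if u: "u \<in> C" "wt u div 2 = i" for u
    proof -
      have "u = 0" using d[OF u(1)] u(2) \<open>i \<le> 2 * k\<close> by linarith
      then show ?thesis using u(2) by (simp add: wt_zero)
    qed
    show ?thesis
    proof (cases "i = 0")
      case True
      then show ?thesis using only_0 self_dual_zero[OF sd] by (auto simp: wt_zero)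
    next
      case False
      then show ?thesis using only_0 by auto
    qed
  qed
  have "fps_nth F (2 * k + 3) < 0"
    unfolding F_def
  proof (rule gleason_third_coefficient_negative[OF k], fold F_def)
    show "fps_nth F 0 = 1" unfolding F using small[of 0] by simp
    show "fps_nth F i = 0" if "0 < i" "i \<le> 2 * k" for i
      unfolding F using small[of i] that by simp
  qed
  then show False unfolding F by simp
qed

section \<open>Neighbours of a doubly even code\<close>

lemma vec_add_self: "v + (v + x) = x" for v x :: "bit ^ 'n"
proof -
  have "a + (a + b) = b" for a b :: bit by (cases a; cases b) simp_all
  then show ?thesis unfolding vec_eq_iff vector_add_component by blast
qed

text \<open>
  The orthogonal space of the hyperplane section \<open>{u \<in> D. dot u v = 0}\<close> is spanned by \<open>D\<close> and \<open>v\<close>: on \<open>D\<close>, a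
  functional vanishing on the kernel of another one is 0 or equal to it.
\<close>

lemma orthogonal_to_hyperplane_section:
  assumes sd: "self_dual D" and y: "\<And>u. u \<in> D \<Longrightarrow> dot u v = 0 \<Longrightarrow> dot u y = 0"
  shows "y \<in> D \<or> v + y \<in> D"
proof (rule disjCI)
  assume "v + y \<notin> D"
  then obtain w where w: "w \<in> D" "dot (v + y) w \<noteq> 0"
    using self_dual_memI[OF sd] by blast
  have wv: "dot w v = 1 \<and> dot w y = 0"
  proof -
    have "dot w v + dot w y \<noteq> 0"
      using w(2) by (simp only: dot_commute[of w] dot_add_left not_False_eq_True)
    moreover have "a + b \<noteq> 0 \<Longrightarrow> (a = 0 \<Longrightarrow> b = 0) \<Longrightarrow> a = 1 \<and> b = 0" for a b :: bit
      by (cases a; cases b) simp_all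
    ultimately show ?thesis using y[OF w(1)] by blast
  qed
  show "y \<in> D"
  proof (rule self_dual_memI[OF sd])
    fix u assume u: "u \<in> D"
    have "dot u y = 0"
    proof (cases "dot u v = 0")
      case True
      then show ?thesis using y[OF u] by blast
    next
      case False
      then have "dot (u + w) v = 0"
        using wv unfolding dot_add_left by simp
      then have "dot (u + w) y = 0"
        using y[OF self_dual_add[OF sd u w(1)]] by blast
      then show ?thesis using wv unfolding dot_add_left by simp
    qed
    then show "dot y u = 0" by (simp only: dot_commute)
  qed
qed

text \<open>
  The span of \<open>v\<close> and \<open>{u \<in> D. dot u v = 0}\<close> when \<open>v\<close> is self-orthogonal.
\<close>

definition neighbor :: "(bit ^ 'n) set \<Rightarrow> bit ^ 'n \<Rightarrow> (bit ^ 'n) set" where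
  "neighbor D v = {x. dot x v = 0 \<and> (x \<in> D \<or> v + x \<in> D)}"

lemma self_dual_neighbor:
  fixes D :: "(bit ^ 'n) set"
  assumes sd: "self_dual D" and v: "dot v v = 0"
  shows "self_dual (neighbor D v)"
proof -
  let ?N = "neighbor D v"
  have add: "x + y \<in> ?N" if "x \<in> ?N" "y \<in> ?N" for x y
  proof -
    have "dot (x + y) v = 0" using that by (simp add: neighbor_def dot_add_left)
    moreover have "x + y \<in> D \<or> v + (x + y) \<in> D"
    proof -
      have "x \<in> D \<or> v + x \<in> D" "y \<in> D \<or> v + y \<in> D" using that by (auto simp: neighbor_def)
      moreover have "(v + x) + y = v + (x + y)" "x + (v + y) = v + (x + y)"
        by (simp_all only: ac_simps)
      moreover have "(v + x) + (v + y) = x + y"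
        using vec_add_self[of v "x + y"] by (simp only: ac_simps)
      ultimately show ?thesis using self_dual_add[OF sd] by metis
    qed
    ultimately show ?thesis by (simp add: neighbor_def)
  qed
  have zero: "0 \<in> ?N"
    using self_dual_zero[OF sd] by (simp add: neighbor_def dot_zero_left)
  have scale: "a *s x \<in> ?N" if "x \<in> ?N" for a x
    using that zero by (cases a) simp_all
  have subspace: "vec.subspace ?N"
    unfolding vec.subspace_def using add zero scale by blast
  have orth: "dot x y = 0" if "x \<in> ?N" "y \<in> ?N" for x y
  proof -
    have z: "dot x v = 0" "dot y v = 0" "dot v y = 0" "dot v x = 0"
      using that dot_commute[of v] by (simp_all only: neighbor_def mem_Collect_eq)
    have e: "dot (v + x) y = dot x y" "dot x (v + y) = dot x y" "dot (v + x) (v + y) = dot x y"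
      unfolding dot_add_left dot_add_right z v by simp_all
    have "x \<in> D \<or> v + x \<in> D" "y \<in> D \<or> v + y \<in> D" using that by (auto simp: neighbor_def)
    then show ?thesis using self_dual_dot[OF sd] e by metis
  qed
  have "x \<in> ?N" if x: "x \<in> dual_code ?N" for x
  proof -
    have o: "dot u x = 0" if "u \<in> ?N" for u
      using x that by (simp only: dual_code_def mem_Collect_eq dot_commute[of u])
    have "v \<in> ?N"
      using v vec_add_self[of v 0] self_dual_zero[OF sd] by (simp add: neighbor_def)
    then have "dot x v = 0" using o dot_commute by metis
    moreover have "x \<in> D \<or> v + x \<in> D"
      by (rule orthogonal_to_hyperplane_section[OF sd]) (simp add: o neighbor_def)
    ultimately show ?thesis by (simp add: neighbor_def)
  qed
  then have "?N = dual_code ?N"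
    using orth by (auto simp: dual_code_def)
  then show ?thesis using subspace by (simp only: self_dual_def)
qed

section \<open>Nonexistence\<close>

lemma min_weight_le: "u \<in> S \<Longrightarrow> u \<noteq> 0 \<Longrightarrow> min_weight S \<le> wt u"
  unfolding min_weight_def by (intro Min_le) auto

lemma hamming_dist_eq_wt: "hamming_dist x y = wt (x + y)"
proof -
  have "a \<noteq> b \<longleftrightarrow> a + b \<noteq> 0" for a b :: bit by (cases a; cases b) simp_all
  then show ?thesis by (simp only: hamming_dist_def wt_def vector_add_component)
qed

lemma covering_radius_attained:
  fixes D :: "(bit ^ 'n) set"
  assumes "D \<noteq> {}" "0 < covering_radius D"
  shows "\<exists>x. (\<forall>c\<in>D. covering_radius D \<le> hamming_dist c x) \<and>
    (\<exists>c\<in>D. hamming_dist c x = covering_radius D)"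
proof -
  let ?P = "\<lambda>R. (\<Union>c\<in>D. {x. hamming_dist c x \<le> R}) = UNIV"
  have "?P CARD('n)"
    using assms(1) wt_le by (auto simp: hamming_dist_eq_wt)
  then have P: "?P (covering_radius D)"
    unfolding covering_radius_def by (rule LeastI)
  have "\<not> ?P (covering_radius D - 1)"
    using not_less_Least[of "covering_radius D - 1" ?P] assms(2) by (simp add: covering_radius_def)
  then obtain x where x: "\<And>c. c \<in> D \<Longrightarrow> \<not> hamming_dist c x \<le> covering_radius D - 1" by blast
  obtain c where "c \<in> D" "hamming_dist c x \<le> covering_radius D" using P by blast
  moreover have "covering_radius D \<le> hamming_dist c x" if "c \<in> D" for c
    using x[OF that] by linarith
  ultimately show ?thesis by (metis le_antisym)
qed

lemma no_s_extremal_code: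
  fixes C :: "(bit ^ 'n) set"
  assumes k: "137 \<le> k" and C: "linear_code_dist (24 * k + 8) (12 * k + 4) (4 * k + 2) C"
    and s: "s_extremal C"
  shows False
proof -
  have n: "CARD('n) = 24 * k + 8" and d: "min_weight C = 4 * k + 2"
    using C by (auto simp: linear_code_dist_def linear_code_def)
  have se: "singly_even_self_dual C" and "real (min_weight (shadow C)) = 4 * real k + 4"
    using s by (simp_all add: s_extremal_def d n)
  then have S: "min_weight (shadow C) = 4 * k + 4" by linarith
  have sd: "self_dual C" using se by (simp add: singly_even_self_dual_def)
  show False
  proof (rule no_self_dual_code_with_long_shadow[OF k n sd])
    show "4 * k + 2 \<le> wt u" if "u \<in> C" "u \<noteq> 0" for u
      using min_weight_le[OF that] d by simp
    show "4 * k + 4 \<le> wt v" if "v \<in> half_weight_coset C" for v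
    proof -
      have v: "v \<in> shadow C" using half_weight_coset_subset_shadow[OF se] that by blast
      then have "v \<noteq> 0" using self_dual_zero[OF sd] by (auto simp: shadow_def)
      then show ?thesis using min_weight_le[OF v] S by simp
    qed
  qed
qed

text \<open>
  A coset \<open>v + D\<close> of minimum weight \<open>4k + 2\<close> gives a neighbour with nonzero weights at least \<open>4k + 2\<close>. An element \<open>y\<close> of
  its half-weight coset is orthogonal to \<open>{u \<in> D. dot u v = 0}\<close>, whose weights are divisible by 4, so \<open>y\<close> lies in \<open>D\<close> or in
  \<open>v + D\<close>. In \<open>D\<close> it is nonzero because it is not orthogonal to \<open>v\<close>, so its weight is at least \<open>4k + 4\<close>; in
  \<open>v + D\<close> its weight is at least \<open>4k + 2\<close> and divisible by 4.
\<close>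

lemma no_extremal_code_with_large_covering_radius:
  fixes D :: "(bit ^ 'n) set"
  assumes k: "137 \<le> k" and D: "linear_code_dist (24 * k + 8) (12 * k + 4) (4 * k + 4) D"
    and de: "doubly_even_self_dual D" and R: "covering_radius D = 4 * k + 2"
  shows False
proof -
  have n: "CARD('n) = 24 * k + 8" and d: "min_weight D = 4 * k + 4"
    using D by (auto simp: linear_code_dist_def linear_code_def)
  have sd: "self_dual D" and de4: "\<And>u. u \<in> D \<Longrightarrow> wt u mod 4 = 0"
    using de by (auto simp: doubly_even_self_dual_def)
  obtain x c where x: "\<And>c. c \<in> D \<Longrightarrow> 4 * k + 2 \<le> wt (c + x)" and c: "c \<in> D" "wt (c + x) = 4 * k + 2"
    using covering_radius_attained[of D] self_dual_zero[OF sd] unfolding R hamming_dist_eq_wt by auto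
  define v where "v = c + x"
  have wv: "wt v = 4 * k + 2" using c by (simp add: v_def)
  have coset: "4 * k + 2 \<le> wt y" if "v + y \<in> D" for y
  proof -
    have "(c + (v + y)) + x = v + (v + y)" by (simp only: v_def ac_simps)
    then show ?thesis
      using x[OF self_dual_add[OF sd c(1) that]] by (simp only: vec_add_self)
  qed
  have "dot v v = 0" by (simp only: dot_self wv of_nat_bit) simp
  then have sdN: "self_dual (neighbor D v)" by (rule self_dual_neighbor[OF sd])
  show False
  proof (rule no_self_dual_code_with_long_shadow[OF k n sdN])
    show "4 * k + 2 \<le> wt u" if "u \<in> neighbor D v" "u \<noteq> 0" for u
    proof -
      have "u \<in> D \<or> v + u \<in> D" using that by (simp add: neighbor_def)
      then show ?thesis using coset[of u] min_weight_le[of u D] that(2) d by auto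
    qed
    show "4 * k + 4 \<le> wt y" if y: "y \<in> half_weight_coset (neighbor D v)" for y
    proof -
      have dot_y: "dot u y = of_nat (wt u div 2)" if "u \<in> neighbor D v" for u
        using y that by (simp only: half_weight_coset_def mem_Collect_eq)
      have "v \<in> neighbor D v"
        using \<open>dot v v = 0\<close> vec_add_self[of v 0] self_dual_zero[OF sd] by (simp add: neighbor_def)
      then have "dot v y = of_nat (2 * k + 1)" using dot_y wv by simp
      then have "dot v y \<noteq> 0" by (simp only: of_nat_bit) simp
      then have "y \<noteq> 0" using dot_zero_left[of v] dot_commute[of v 0] by auto
      have "y \<in> D \<or> v + y \<in> D"
      proof (rule orthogonal_to_hyperplane_section[OF sd])
        fix u assume u: "u \<in> D" "dot u v = 0"
        then have "dot u y = of_nat (wt u div 2)" by (intro dot_y) (simp add: neighbor_def)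
        moreover have "even (wt u div 2)" using de4[OF u(1)] by presburger
        ultimately show "dot u y = 0" by (simp only: of_nat_bit)
      qed
      then show ?thesis
      proof
        assume "y \<in> D"
        then show ?thesis using min_weight_le[of y D] \<open>y \<noteq> 0\<close> d by simp
      next
        assume "v + y \<in> D"
        then have "4 * k + 2 \<le> wt y" by (rule coset)
        moreover have "wt y mod 4 = 0"
          by (rule half_weight_coset_wt_mod_4[OF sdN _ y]) (simp add: n)
        ultimately show ?thesis by presburger
      qed
    qed
  qed
qed

theorem theorem8:
  shows "(\<forall>k\<ge>137. \<nexists>C :: (bit ^ 'n) set.
            linear_code_dist (24 * k + 8) (12 * k + 4) (4 * k + 2) C \<and>
            singly_even_self_dual C \<and> s_extremal C)
       \<and> (\<forall>k\<ge>137. \<nexists>C :: (bit ^ 'n) set.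
            linear_code_dist (24 * k + 8) (12 * k + 4) (4 * k + 4) C \<and>
            doubly_even_self_dual C \<and> extremal C \<and>
            covering_radius C = 4 * k + 2 \<and> meets_delsarte_bound C)"
  using no_s_extremal_code no_extremal_code_with_large_covering_radius by metis

end
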